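(* Let $\lambda=(\lambda_1,\dots,\lambda_t)\vdash k$ be a fixed partition, let $n\ge\lambda_1$ be an integer, and let $r$ be a positive integer with $r\mid (n+k)$. Then $$\chi^{(n,\lambda)}_{r^{\frac{n+k}{r}}}=\sum_{\substack{0\le j\le t\\ r\mid (k-j)}} (-1)^j \binom{\frac{n+k}{r}}{\frac{k-j}{r}}\, \chi^{\lambda/(1^j)}_{r^{\frac{k-j}{r}}}.$$ In particular, for fixed $\lambda$ and $r$, $\chi^{(n,\lambda)}_{r^{\frac{n+k}{r}}}$ is a polynomial in $n$ (i.e. there is a polynomial with rational coefficients whose value at $n$ equals $\chi^{(n,\lambda)}_{r^{\frac{n+k}{r}}}$ for all integers $n\ge\lambda_1$ with $r\mid(n+k)$).
   Context: Here $\lambda_1\ge\dots\ge\lambda_t\ge 1$ are the (positive) parts of $\lambda$, with $\lambda_1+\dots+\lambda_t=k$. $(n,\lambda):=(n,\lambda_1,\dots,\lambda_t)$, a partition of $n+k$. $(1^j)$ denotes the partition with $j$ parts all equal to $1$ (empty for $j=0$). For a partition $\mu\vdash N$, $\chi^\mu$ is the irreducible complex character of the symmetric group $S_N$ indexed by $\mu$; for a skew shape $\lambda/\mu$ of size $N$, $\chi^{\lambda/\mu}$ is the skew character of $S_N$, i.e. the character whose Frobenius characteristic is the skew Schur function $s_{\lambda/\mu}$. For a character $\chi$ of $S_N$ and a cycle type $\alpha\vdash N$, $\chi_\alpha$ denotes the value of $\chi$ on permutations of cycle type $\alpha$; $r^{s}$ denotes the cycle type consisting of $s$ cycles of length $r$.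 The character of $S_0$ attached to an empty shape takes the value $1$. *)

theory Defs
  imports
    "HOL-Library.Poly_Mapping"
    "HOL-Computational_Algebra.Polynomial"
    "HOL-Combinatorics.Orbits"
    "HOL-Algebra.Sym_Groups"
    "Jordan_Normal_Form.VS_Connect"
begin

section \<open>Partitions, skew shapes and skew Schur functions\<close>

definition is_partition :: "nat list \<Rightarrow> bool" where
  "is_partition lam \<longleftrightarrow> sorted_wrt (\<ge>) lam \<and> (\<forall>l\<in>set lam. l \<ge> 1)"

text \<open>Rows and columns are indexed from 0; parts beyond the end of a list count as 0.\<close>

definition part :: "nat list \<Rightarrow> nat \<Rightarrow> nat" where
  "part lam i = (if i < length lam then lam ! i else 0)"

definition skew_diagram :: "nat list \<Rightarrow> nat list \<Rightarrow> (nat \<times> nat) set" where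
  "skew_diagram lam mu = {(i, j). part mu i \<le> j \<and> j < part lam i}"

text \<open>Semistandard tableaux with entries in \<open>{0..<M}\<close>, corresponding to the variables
  \<open>x\<^sub>0, \<dots>, x\<^sub>M\<^sub>-\<^sub>1\<close>.\<close>

definition ssyt :: "nat list \<Rightarrow> nat list \<Rightarrow> nat \<Rightarrow> (nat \<times> nat \<Rightarrow> nat) set" where
  "ssyt lam mu M = {T \<in> skew_diagram lam mu \<rightarrow>\<^sub>E {..<M}.
     (\<forall>i j j'. (i, j) \<in> skew_diagram lam mu \<longrightarrow> (i, j') \<in> skew_diagram lam mu \<longrightarrow>
        j < j' \<longrightarrow> T (i, j) \<le> T (i, j')) \<and>
     (\<forall>i i' j. (i, j) \<in> skew_diagram lam mu \<longrightarrow> (i', j) \<in> skew_diagram lam mu \<longrightarrow>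
        i < i' \<longrightarrow> T (i, j) < T (i', j))}"

text \<open>A polynomial maps exponent vectors to coefficients. A symmetric function \<open>f\<close> is
  represented, as in the inverse limit definition of the ring of symmetric functions, by the
  sequence of its restrictions \<open>f(x\<^sub>0, \<dots>, x\<^sub>M\<^sub>-\<^sub>1)\<close> for all numbers \<open>M\<close> of variables.\<close>

type_synonym cpoly = "(nat \<Rightarrow>\<^sub>0 nat) \<Rightarrow>\<^sub>0 complex"
type_synonym symfun = "nat \<Rightarrow> cpoly"

definition cpoly_const :: "complex \<Rightarrow> cpoly" where
  "cpoly_const c = Poly_Mapping.single 0 c"

definition cpoly_var :: "nat \<Rightarrow> cpoly" where
  "cpoly_var i = Poly_Mapping.single (Poly_Mapping.single i 1) 1"

definition skew_schur :: "nat list \<Rightarrow> nat list \<Rightarrow> symfun" where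
  "skew_schur lam mu M =
     (\<Sum>T\<in>ssyt lam mu M. \<Prod>c\<in>skew_diagram lam mu. cpoly_var (T c))"

definition power_sum :: "nat \<Rightarrow> symfun" where
  "power_sum r M = (\<Sum>i<M. cpoly_var i ^ r)"

section \<open>Complex characters of symmetric groups\<close>

text \<open>The units of the matrix ring form \<open>GL\<^sub>d(\<complex>)\<close>.\<close>

definition representation :: "nat \<Rightarrow> nat \<Rightarrow> ((nat \<Rightarrow> nat) \<Rightarrow> complex mat) \<Rightarrow> bool" where
  "representation N d \<rho> \<longleftrightarrow>
     \<rho> \<in> hom (sym_group N) (units_of (ring_mat TYPE(complex) d ()))"

definition irreducible_representation ::
  "nat \<Rightarrow> nat \<Rightarrow> ((nat \<Rightarrow> nat) \<Rightarrow> complex mat) \<Rightarrow> bool" where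
  "irreducible_representation N d \<rho> \<longleftrightarrow> representation N d \<rho> \<and> d > 0 \<and>
     (\<forall>W. VectorSpace.subspace class_ring W (module_vec TYPE(complex) d) \<and>
          (\<forall>w\<in>carrier (sym_group N). \<forall>v\<in>W. \<rho> w *\<^sub>v v \<in> W) \<longrightarrow>
        W = {0\<^sub>v d} \<or> W = carrier_vec d)"

text \<open>Characters are functions on permutations; only their values on the carrier of the
  symmetric group matter.\<close>

definition affords ::
  "nat \<Rightarrow> nat \<Rightarrow> ((nat \<Rightarrow> nat) \<Rightarrow> complex mat) \<Rightarrow> ((nat \<Rightarrow> nat) \<Rightarrow> complex) \<Rightarrow> bool" where
  "affords N d \<rho> \<chi> \<longleftrightarrow> (\<forall>w\<in>carrier (sym_group N). \<chi> w = (\<Sum>i<d. \<rho> w $$ (i, i)))"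

definition is_character :: "nat \<Rightarrow> ((nat \<Rightarrow> nat) \<Rightarrow> complex) \<Rightarrow> bool" where
  "is_character N \<chi> \<longleftrightarrow> (\<exists>d \<rho>. representation N d \<rho> \<and> affords N d \<rho> \<chi>)"

definition is_irreducible_character :: "nat \<Rightarrow> ((nat \<Rightarrow> nat) \<Rightarrow> complex) \<Rightarrow> bool" where
  "is_irreducible_character N \<chi> \<longleftrightarrow>
     (\<exists>d \<rho>. irreducible_representation N d \<rho> \<and> affords N d \<rho> \<chi>)"

text \<open>The cycle type includes the fixed points, as cycles of length 1.\<close>

definition cycle_type :: "nat \<Rightarrow> (nat \<Rightarrow> nat) \<Rightarrow> nat multiset" where
  "cycle_type N w = image_mset card (mset_set (orbit w ` {1..N}))"

text \<open>The value \<open>\<chi>\<^sub>\<alpha>\<close>; for a character of \<open>S\<^sub>N\<close> and a partition \<open>\<alpha>\<close> of \<open>N\<close> it does not depend on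
  the chosen permutation.\<close>

definition character_value ::
  "nat \<Rightarrow> ((nat \<Rightarrow> nat) \<Rightarrow> complex) \<Rightarrow> nat multiset \<Rightarrow> complex" where
  "character_value N \<chi> \<alpha> =
     \<chi> (SOME w. w \<in> carrier (sym_group N) \<and> cycle_type N w = \<alpha>)"

definition frobenius_characteristic :: "nat \<Rightarrow> ((nat \<Rightarrow> nat) \<Rightarrow> complex) \<Rightarrow> symfun" where
  "frobenius_characteristic N \<chi> M =
     cpoly_const (1 / fact N) *
     (\<Sum>w\<in>carrier (sym_group N). cpoly_const (\<chi> w) * (\<Prod>r\<in>#cycle_type N w. power_sum r M))"

text \<open>\<open>\<chi>\<close> is \<open>\<chi>\<^bsup>lam/mu\<^esup>\<close>, a character of \<open>S\<^sub>N\<close>. The Frobenius characteristic determines a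
  character on \<open>S\<^sub>N\<close>, so these predicates specify \<open>\<chi>\<close> uniquely there.\<close>

definition is_skew_character ::
  "nat \<Rightarrow> nat list \<Rightarrow> nat list \<Rightarrow> ((nat \<Rightarrow> nat) \<Rightarrow> complex) \<Rightarrow> bool" where
  "is_skew_character N lam mu \<chi> \<longleftrightarrow>
     is_character N \<chi> \<and> frobenius_characteristic N \<chi> = skew_schur lam mu"

text \<open>\<open>\<chi>\<close> is \<open>\<chi>\<^bsup>mu\<^esup>\<close>. The indexing of the irreducible characters by partitions is fixed by
  requiring that the Frobenius characteristic be the Schur function \<open>s\<^bsub>mu\<^esub>\<close>.\<close>

definition is_irreducible_character_of ::
  "nat \<Rightarrow> nat list \<Rightarrow> ((nat \<Rightarrow> nat) \<Rightarrow> complex) \<Rightarrow> bool" where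
  "is_irreducible_character_of N mu \<chi> \<longleftrightarrow>
     is_irreducible_character N \<chi> \<and> frobenius_characteristic N \<chi> = skew_schur mu []"

end

theory Submission
  imports Defs "HOL-Computational_Algebra.Polynomial_FPS"
begin

text \<open>The proof evaluates symmetric functions at \<open>s\<close> copies of the \<open>r\<close>-th roots of unity. At these points
  the power sum \<open>p\<^sub>c\<close> is \<open>r s\<close> if \<open>r\<close> divides \<open>c\<close> and 0 otherwise, so the Frobenius characteristic of
  a character \<open>\<chi>\<close> of \<open>S\<^sub>N\<close> becomes a polynomial in \<open>s\<close> (\<open>cycle_poly\<close>), to which a permutation
  contributes only in the degree given by its number of cycles. If \<open>r\<close> does not divide \<open>N\<close>, this
  polynomial is 0. If \<open>N = r m\<close>, its degree is at most \<open>m\<close>, and only permutations of cycle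
  type \<open>r\<^sup>m\<close> contribute to the coefficient of \<open>s\<^sup>m\<close>. That coefficient is the value of \<open>\<chi>\<close> at \<open>r\<^sup>m\<close> divided
  by \<open>m!\<close> (\<open>coeff_cycle_poly_character\<close>). The factor \<open>1 / m!\<close> is obtained from the trivial character:
  its characteristic is the complete homogeneous function \<open>h\<^sub>N\<close> (\<open>cycle_index_eq_complete_hom\<close>), whose
  value at these points is \<open>s (s + 1) \<dots> (s + m - 1) / m!\<close> (\<open>complete_hom_unity_roots\<close>).

  The formula is the comparison of the coefficients of \<open>s\<close> to the power \<open>(n + k) / r\<close> in the identity
  \<open>s\<^bsub>(n, \<lambda>)\<^esub> = (\<Sum>j\<le>t. (- 1)\<^sup>j h\<^bsub>n + j\<^esub> s\<^bsub>\<lambda>/(1\<^sup>j)\<^esub>)\<close> (\<open>tableau_sum_first_row_expansion\<close>): in the product of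
  \<open>h\<^sub>n\<^sub>+\<^sub>j\<close> with the characteristic of the skew character the coefficient is the skew character value times
  two reciprocal factorials, and multiplying by \<open>((n + k) / r)!\<close> makes them a binomial coefficient.

  The identity is the Laplace expansion of a Jacobi-Trudi determinant along its first row. The
  Jacobi-Trudi identity for tableau sums (\<open>det_jacobi_trudi\<close>) follows by induction on the number of
  variables: row operations show that the determinant satisfies the branching rule for
  semistandard tableaux. It also shows that the polynomials of the skew characters have rational
  coefficients, so the skew character values are rational and the right-hand side of the formula,
  in which \<open>n\<close> occurs only in the binomial coefficients, is a rational polynomial in \<open>n\<close>.\<close>

section \<open>Complete homogeneous polynomials\<close>

definition multisets_below :: "nat \<Rightarrow> nat \<Rightarrow> nat multiset set" where
  "multisets_below M d = {A. set_mset A \<subseteq> {..<M} \<and> size A = d}"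

text \<open>The monomials of \<open>h\<^sub>d\<close> are indexed by multisets of variables, the form in which they arise below
  as types of colourings.\<close>

definition complete_hom :: "(nat \<Rightarrow> 'a::comm_semiring_1) \<Rightarrow> nat \<Rightarrow> nat \<Rightarrow> 'a" where
  "complete_hom x M d = (\<Sum>A\<in>multisets_below M d. \<Prod>i\<in>#A. x i)"

lemma finite_multisets_below: "finite (multisets_below M d)"
proof (rule finite_subset)
  show "multisets_below M d \<subseteq> mset ` {xs. set xs \<subseteq> {..<M} \<and> length xs = d}"
  proof
    fix A assume "A \<in> multisets_below M d"
    moreover obtain xs where "A = mset xs" using ex_mset[of A] by metis
    ultimately show "A \<in> mset ` {xs. set xs \<subseteq> {..<M} \<and> length xs = d}"
      by (auto simp: multisets_below_def)
  qed
qed (intro finite_imageI finite_lists_length_eq, simp)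

lemma complete_hom_0_right [simp]: "complete_hom x M 0 = 1"
proof -
  have "multisets_below M 0 = {{#}}" by (auto simp: multisets_below_def)
  then show ?thesis by (simp add: complete_hom_def)
qed

lemma complete_hom_0_left: "complete_hom x 0 d = (if d = 0 then 1 else 0)"
proof (cases "d = 0")
  case False
  then have "multisets_below 0 d = {}" by (auto simp: multisets_below_def)
  with False show ?thesis by (simp add: complete_hom_def)
qed simp

text \<open>A monomial of degree \<open>d + 1\<close> either avoids the last variable or is divisible by it.\<close>

lemma complete_hom_Suc:
  "complete_hom x (Suc M) (Suc d) = complete_hom x M (Suc d) + x M * complete_hom x (Suc M) d"
proof -
  have split: "multisets_below (Suc M) (Suc d) =
      multisets_below M (Suc d) \<union> add_mset M ` multisets_below (Suc M) d"
  proof (intro equalityI subsetI)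
    fix A assume A: "A \<in> multisets_below (Suc M) (Suc d)"
    show "A \<in> multisets_below M (Suc d) \<union> add_mset M ` multisets_below (Suc M) d"
    proof (cases "M \<in># A")
      case True
      then obtain B where B: "A = add_mset M B" by (metis mset_add)
      with A have "B \<in> multisets_below (Suc M) d" by (auto simp: multisets_below_def)
      with B show ?thesis by blast
    next
      case False
      with A show ?thesis by (force simp: multisets_below_def less_Suc_eq)
    qed
  qed (auto simp: multisets_below_def)
  have "multisets_below M (Suc d) \<inter> add_mset M ` multisets_below (Suc M) d = {}"
    by (auto simp: multisets_below_def)
  then have "complete_hom x (Suc M) (Suc d) = complete_hom x M (Suc d) +
      (\<Sum>A\<in>add_mset M ` multisets_below (Suc M) d. \<Prod>i\<in>#A. x i)"
    unfolding complete_hom_def split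
    by (intro sum.union_disjoint finite_imageI finite_multisets_below)
  also have "(\<Sum>A\<in>add_mset M ` multisets_below (Suc M) d. \<Prod>i\<in>#A. x i)
      = x M * complete_hom x (Suc M) d"
    by (subst sum.reindex) (auto simp: inj_on_def complete_hom_def sum_distrib_left)
  finally show ?thesis .
qed

text \<open>The indices in a Jacobi-Trudi matrix can be negative.\<close>

definition complete_hom_int :: "(nat \<Rightarrow> 'a::comm_semiring_1) \<Rightarrow> nat \<Rightarrow> int \<Rightarrow> 'a" where
  "complete_hom_int x M d = (if d < 0 then 0 else complete_hom x M (nat d))"

lemma complete_hom_int_rec:
  "complete_hom_int x (Suc M) d = complete_hom_int x M d + x M * complete_hom_int x (Suc M) (d - 1)"
proof (cases "d \<le> 0")
  case True
  then consider "d < 0" | "d = 0" by linarith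
  then show ?thesis by cases (simp_all add: complete_hom_int_def)
next
  case False
  define n where "n = nat (d - 1)"
  with False have "nat d = Suc n" "nat (d - 1) = n" "\<not> d < 0" "\<not> d - 1 < 0" by simp_all
  then show ?thesis by (simp only: complete_hom_int_def complete_hom_Suc if_False)
qed

text \<open>Subtracting a multiple of a shifted index truncates the expansion in powers of the last
  variable. In the Jacobi-Trudi matrix this is a row operation, and the truncation is the bound
  \<open>\<lambda>\<^sub>i\<^sub>+\<^sub>1 \<le> \<nu>\<^sub>i\<close> of a horizontal strip.\<close>

lemma complete_hom_int_telescope:
  "complete_hom_int x (Suc M) d =
    (\<Sum>i<e. x M ^ i * complete_hom_int x M (d - int i)) + x M ^ e * complete_hom_int x (Suc M) (d - int e)"
proof (induction e)
  case (Suc e)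
  have "x M ^ e * complete_hom_int x (Suc M) (d - int e) =
      x M ^ e * complete_hom_int x M (d - int e) + x M ^ Suc e * complete_hom_int x (Suc M) (d - int (Suc e))"
    by (subst complete_hom_int_rec) (simp add: algebra_simps)
  with Suc show ?case by (simp add: add.assoc)
qed simp

section \<open>The Jacobi-Trudi identity\<close>

text \<open>These are the \<open>\<nu>\<close> for which \<open>\<lambda>/\<nu>\<close> is a horizontal strip, that is, for which \<open>\<nu>\<close> can be
  the shape that the entries below the largest one occupy in a semistandard tableau of shape \<open>\<lambda>\<close>.\<close>

definition interlacing :: "(nat \<Rightarrow> nat) \<Rightarrow> (nat \<Rightarrow> nat) set" where
  "interlacing lam = {nu. \<forall>i. lam (Suc i) \<le> nu i \<and> nu i \<le> lam i}"

text \<open>The rows are chosen independently, so multiplying out a product over the rows gives a sum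
  over horizontal strips.\<close>

lemma
  fixes f :: "nat \<Rightarrow> nat \<Rightarrow> 'a::comm_semiring_1"
  assumes "\<And>i. i \<ge> L \<Longrightarrow> lam i = 0"
  shows finite_interlacing: "finite (interlacing lam)"
    and prod_sum_interlacing: "(\<Prod>i<L. \<Sum>v=lam (Suc i)..lam i. f i v) =
      (\<Sum>nu\<in>interlacing lam. \<Prod>i<L. f i (nu i))"
proof -
  define P where "P = (\<Pi>\<^sub>E i\<in>{..<L}. {lam (Suc i)..lam i})"
  have bij: "bij_betw (\<lambda>nu. restrict nu {..<L}) (interlacing lam) P"
  proof (rule bij_betw_byWitness[where f' = "\<lambda>g i. if i < L then g i else 0"])
    show "\<forall>nu\<in>interlacing lam. (\<lambda>i. if i < L then restrict nu {..<L} i else 0) = nu"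
    proof
      fix nu assume "nu \<in> interlacing lam"
      then have "nu i = 0" if "i \<ge> L" for i
        using assms[OF that] by (metis (mono_tags, lifting) interlacing_def le_zero_eq mem_Collect_eq)
      then show "(\<lambda>i. if i < L then restrict nu {..<L} i else 0) = nu" by (auto simp: fun_eq_iff)
    qed
    show "\<forall>g\<in>P. restrict (\<lambda>i. if i < L then g i else 0) {..<L} = g"
      by (auto simp: P_def fun_eq_iff PiE_def extensional_def)
    show "(\<lambda>nu. restrict nu {..<L}) ` interlacing lam \<subseteq> P"
      by (auto simp: P_def interlacing_def split: if_splits)
    show "(\<lambda>g i. if i < L then g i else 0) ` P \<subseteq> interlacing lam"
      using assms by (auto simp: P_def interlacing_def PiE_def Pi_def)
  qed
  have "finite P" unfolding P_def by (intro finite_PiE) auto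
  with bij show "finite (interlacing lam)" by (simp add: bij_betw_finite)
  have "(\<Prod>i<L. \<Sum>v=lam (Suc i)..lam i. f i v) = (\<Sum>g\<in>P. \<Prod>i<L. f i (g i))"
    unfolding P_def by (rule prod_sum_PiE) auto
  also have "\<dots> = (\<Sum>nu\<in>interlacing lam. \<Prod>i<L. f i (restrict nu {..<L} i))"
    by (rule sum.reindex_bij_betw[OF bij, symmetric])
  also have "\<dots> = (\<Sum>nu\<in>interlacing lam. \<Prod>i<L. f i (nu i))" by simp
  finally show "(\<Prod>i<L. \<Sum>v=lam (Suc i)..lam i. f i v) = (\<Sum>nu\<in>interlacing lam. \<Prod>i<L. f i (nu i))" .
qed

text \<open>The size \<open>L\<close> is a parameter because \<open>\<nu>\<close> can have fewer parts than \<open>\<lambda>\<close> when \<open>\<lambda>/\<nu>\<close> is a horizontal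
  strip, and both need matrices of the same size.\<close>

definition jacobi_trudi ::
  "(nat \<Rightarrow> 'a::comm_ring_1) \<Rightarrow> nat \<Rightarrow> nat \<Rightarrow> (nat \<Rightarrow> nat) \<Rightarrow> (nat \<Rightarrow> nat) \<Rightarrow> 'a mat" where
  "jacobi_trudi x M L lam mu =
     mat L L (\<lambda>(i, j). complete_hom_int x M (int (lam i) - int i - int (mu j) + int j))"

text \<open>Let \<open>A\<close> be the matrix for \<open>M + 1\<close> variables. Subtracting from each row the right multiple of the
  next one is multiplication by a unitriangular matrix \<open>U\<close>, so it keeps the determinant. By the
  telescoping identity, row \<open>i\<close> of \<open>U A\<close> is a sum over \<open>\<lambda>\<^sub>i\<^sub>+\<^sub>1 \<le> \<nu>\<^sub>i \<le> \<lambda>\<^sub>i\<close> of multiples of rows for \<open>M\<close>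
  variables, and multilinearity turns the determinant into a sum over horizontal strips. This is
  the branching rule that the tableau sum satisfies.\<close>

lemma det_jacobi_trudi_Suc:
  assumes anti: "antimono lam" and L: "\<And>i. i \<ge> L \<Longrightarrow> lam i = 0"
  shows "det (jacobi_trudi x (Suc M) L lam mu) =
    (\<Sum>nu\<in>interlacing lam. x M ^ (\<Sum>i<L. lam i - nu i) * det (jacobi_trudi x M L nu mu))"
proof -
  define A where "A = jacobi_trudi x (Suc M) L lam mu"
  define U :: "'a mat" where "U = mat L L (\<lambda>(i, j). if i = j then 1 else
    if j = Suc i then - (x M ^ (Suc (lam i) - lam (Suc i))) else 0)"
  define h where "h i j v = complete_hom_int x M (int v - int i - int (mu j) + int j)" for i j v
  have A: "A \<in> carrier_mat L L" and U: "U \<in> carrier_mat L L"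
    by (simp_all add: A_def jacobi_trudi_def U_def)
  have "det U = 1"
  proof -
    have "det U = prod_list (diag_mat U)"
      by (rule det_upper_triangular[OF _ U]) (auto simp: U_def upper_triangular_def)
    also have "\<dots> = 1" unfolding prod_list_diag_prod by (auto simp: U_def intro!: prod.neutral)
    finally show ?thesis .
  qed
  then have "det A = det (U * A)" using det_mult[OF U A] by simp
  have entry: "(U * A) $$ (i, j) = (\<Sum>v=lam (Suc i)..lam i. x M ^ (lam i - v) * h i j v)"
    if ij: "i < L" "j < L" for i j
  proof -
    let ?d = "int (lam i) - int i - int (mu j) + int j" and ?e = "Suc (lam i) - lam (Suc i)"
    have le: "lam (Suc i) \<le> lam i" using anti by (simp add: antimono_def)
    have "(U * A) $$ (i, j) = (\<Sum>k<L. U $$ (i, k) * A $$ (k, j))"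
      using A U ij by (simp add: scalar_prod_def atLeast0LessThan)
    also have "\<dots> = (\<Sum>k\<in>{i} \<union> ({..<L} \<inter> {Suc i}). U $$ (i, k) * A $$ (k, j))"
      by (rule sum.mono_neutral_right) (use ij in \<open>auto simp: U_def\<close>)
    also have "\<dots> = complete_hom_int x (Suc M) ?d - x M ^ ?e * complete_hom_int x (Suc M) (?d - int ?e)"
    proof (cases "Suc i < L")
      case True
      have "(\<Sum>k\<in>{i} \<union> ({..<L} \<inter> {Suc i}). U $$ (i, k) * A $$ (k, j)) =
          U $$ (i, i) * A $$ (i, j) + U $$ (i, Suc i) * A $$ (Suc i, j)"
        using True by (subst sum.union_disjoint) auto
      moreover have "?d - int ?e = int (lam (Suc i)) - int (Suc i) - int (mu j) + int j"
        using le by simp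
      ultimately show ?thesis using ij True
        by (simp only:) (simp add: U_def A_def jacobi_trudi_def)
    next
      \<comment> \<open>The last row has no successor, but the term to be subtracted has a negative index.\<close>
      case False
      with ij have "Suc i = L" by simp
      with L have "lam (Suc i) = 0" by simp
      then have "?d - int ?e < 0" using ij \<open>Suc i = L\<close> by simp
      then have "complete_hom_int x (Suc M) (?d - int ?e) = 0" by (simp add: complete_hom_int_def)
      with \<open>Suc i = L\<close> ij show ?thesis by (simp add: U_def A_def jacobi_trudi_def)
    qed
    also have "\<dots> = (\<Sum>k<?e. x M ^ k * complete_hom_int x M (?d - int k))"
      by (subst complete_hom_int_telescope[where e = ?e]) simp
    also have "\<dots> = (\<Sum>v=lam (Suc i)..lam i. x M ^ (lam i - v) * h i j v)"
      by (rule sum.reindex_bij_witness[of _ "\<lambda>v. lam i - v" "\<lambda>k. lam i - k"])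
        (use le in \<open>auto simp: h_def of_nat_diff algebra_simps\<close>)
    finally show ?thesis .
  qed
  have "det (U * A) = (\<Sum>p | p permutes {0..<L}. signof p *
      (\<Prod>i<L. \<Sum>v=lam (Suc i)..lam i. x M ^ (lam i - v) * h i (p i) v))"
    using U A by (subst det_def'[of _ L])
      (auto simp: atLeast0LessThan entry permutes_in_image simp del: index_mult_mat
        intro!: sum.cong prod.cong arg_cong2[where f = "(*)"])
  also have "\<dots> = (\<Sum>p | p permutes {0..<L}. \<Sum>nu\<in>interlacing lam. signof p *
      (\<Prod>i<L. x M ^ (lam i - nu i) * h i (p i) (nu i)))"
    by (subst prod_sum_interlacing[OF L]) (simp_all add: sum_distrib_left)
  also have "\<dots> = (\<Sum>nu\<in>interlacing lam. \<Sum>p | p permutes {0..<L}. signof p *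
      (\<Prod>i<L. x M ^ (lam i - nu i) * h i (p i) (nu i)))"
    by (rule sum.swap)
  also have "\<dots> = (\<Sum>nu\<in>interlacing lam. x M ^ (\<Sum>i<L. lam i - nu i) *
      (\<Sum>p | p permutes {0..<L}. signof p * (\<Prod>i<L. h i (p i) (nu i))))"
    by (simp add: prod.distrib sum_distrib_left power_sum mult_ac)
  also have "\<dots> = (\<Sum>nu\<in>interlacing lam. x M ^ (\<Sum>i<L. lam i - nu i) * det (jacobi_trudi x M L nu mu))"
    by (subst det_def'[of _ L])
      (auto simp: jacobi_trudi_def h_def atLeast0LessThan permutes_in_image
        intro!: sum.cong prod.cong arg_cong2[where f = "(*)"])
  finally show ?thesis using \<open>det A = det (U * A)\<close> by (simp add: A_def)
qed

text \<open>Without variables an entry is 1 if \<open>\<lambda>\<^sub>i - i = \<mu>\<^sub>j - j\<close> and 0 otherwise. Both sides decrease strictly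
  in their index, so a permutation that contributes to the determinant is increasing, hence the
  identity.\<close>

lemma det_jacobi_trudi_0:
  assumes lam: "antimono lam" and mu: "antimono mu"
  shows "det (jacobi_trudi x 0 L lam mu) = (if \<forall>i<L. lam i = mu i then 1 else 0)"
proof -
  let ?e = "\<lambda>p i. complete_hom_int x 0 (int (lam i) - int i - int (mu (p i)) + int (p i))"
  have e: "?e p i = (if int (lam i) - int i = int (mu (p i)) - int (p i) then 1 else 0)" for p i
    by (auto simp: complete_hom_int_def complete_hom_0_left)
  have "det (jacobi_trudi x 0 L lam mu) =
      (\<Sum>p | p permutes {0..<L}. signof p * (\<Prod>i = 0..<L. ?e p i))"
    by (subst det_def'[of _ L])
      (auto simp: jacobi_trudi_def permutes_in_image
        intro!: sum.cong prod.cong arg_cong2[where f = "(*)"])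
  also have "\<dots> = (\<Sum>p\<in>{id}. signof p * (\<Prod>i = 0..<L. ?e p i))"
  proof (rule sum.mono_neutral_right)
    show "\<forall>p\<in>{p. p permutes {0..<L}} - {id}. signof p * (\<Prod>i = 0..<L. ?e p i) = 0"
    proof (rule ballI, rule ccontr)
      fix p assume p: "p \<in> {p. p permutes {0..<L}} - {id}"
        and "signof p * (\<Prod>i = 0..<L. ?e p i) \<noteq> 0"
      then have "(\<Prod>i = 0..<L. ?e p i) \<noteq> 0" by auto
      then have "\<forall>i<L. ?e p i \<noteq> 0" using prod_zero[of "{0..<L}" "?e p"] by fastforce
      then have eq: "int (lam i) - int i = int (mu (p i)) - int (p i)" if "i < L" for i
        using that e[of i p] by (metis (full_types))
      have mono: "p i < p (Suc i)" if "Suc i < L" for i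
      proof (rule ccontr)
        assume "\<not> p i < p (Suc i)"
        then have "mu (p i) \<le> mu (p (Suc i))" "p (Suc i) \<le> p i"
          using mu by (auto simp: antimono_def)
        moreover have "lam (Suc i) \<le> lam i" using lam by (auto simp: antimono_def)
        ultimately show False using eq[of i] eq[of "Suc i"] that by linarith
      qed
      have "i \<le> p i" if "i < L" for i
        using that by (induction i) (use mono in \<open>force+\<close>)
      then have "p = id" using p by (intro permutes_natset_ge[of p "{0..<L}"]) auto
      with p show False by simp
    qed
  qed (auto simp: finite_permutations permutes_id)
  also have "\<dots> = (\<Prod>i = 0..<L. if lam i = mu i then 1 else 0)"
    by (simp only: e sum.insert sum.empty finite.emptyI empty_iff not_False_eq_True sign_id
      of_int_1 mult_1 id_apply add_0_right) (auto intro!: prod.cong)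
  also have "\<dots> = (if \<forall>i<L. lam i = mu i then 1 else 0)"
    by (auto intro!: prod.neutral prod_zero)
  finally show ?thesis .
qed

text \<open>Shapes are functions from row numbers to row lengths, since the induction on the number of
  variables runs over all horizontal strips and padding with zeros is then automatic. Lists enter
  only through \<^const>\<open>part\<close>.\<close>

definition diagram :: "(nat \<Rightarrow> nat) \<Rightarrow> (nat \<Rightarrow> nat) \<Rightarrow> (nat \<times> nat) set" where
  "diagram lam mu = {(i, j). mu i \<le> j \<and> j < lam i}"

definition tableaux :: "(nat \<Rightarrow> nat) \<Rightarrow> (nat \<Rightarrow> nat) \<Rightarrow> nat \<Rightarrow> (nat \<times> nat \<Rightarrow> nat) set" where
  "tableaux lam mu M = {T \<in> diagram lam mu \<rightarrow>\<^sub>E {..<M}.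
     (\<forall>i j j'. (i, j) \<in> diagram lam mu \<longrightarrow> (i, j') \<in> diagram lam mu \<longrightarrow>
        j < j' \<longrightarrow> T (i, j) \<le> T (i, j')) \<and>
     (\<forall>i i' j. (i, j) \<in> diagram lam mu \<longrightarrow> (i', j) \<in> diagram lam mu \<longrightarrow>
        i < i' \<longrightarrow> T (i, j) < T (i', j))}"

lemma skew_diagram_conv: "skew_diagram lam mu = diagram (part lam) (part mu)"
  by (simp add: skew_diagram_def diagram_def)

lemma ssyt_conv: "ssyt lam mu M = tableaux (part lam) (part mu) M"
  by (simp add: ssyt_def tableaux_def skew_diagram_conv)

definition tableau_sum ::
  "(nat \<Rightarrow> 'a::comm_semiring_1) \<Rightarrow> nat \<Rightarrow> (nat \<Rightarrow> nat) \<Rightarrow> (nat \<Rightarrow> nat) \<Rightarrow> 'a" where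
  "tableau_sum x M lam mu = (\<Sum>T\<in>tableaux lam mu M. \<Prod>c\<in>diagram lam mu. x (T c))"

lemma diagram_eq_Sigma:
  assumes "\<And>i. i \<ge> L \<Longrightarrow> lam i = 0"
  shows "diagram lam mu = (SIGMA i:{..<L}. {mu i..<lam i})"
  using assms by (auto simp: diagram_def) (metis not_less not_less0)

lemma finite_diagram:
  assumes "\<And>i. i \<ge> L \<Longrightarrow> lam i = 0"
  shows "finite (diagram lam mu)"
  using diagram_eq_Sigma[OF assms] by auto

lemma finite_tableaux:
  assumes "\<And>i. i \<ge> L \<Longrightarrow> lam i = 0"
  shows "finite (tableaux lam mu M)"
proof (rule finite_subset)
  show "tableaux lam mu M \<subseteq> diagram lam mu \<rightarrow>\<^sub>E {..<M}" by (auto simp: tableaux_def)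
  show "finite (diagram lam mu \<rightarrow>\<^sub>E {..<M})"
    using finite_diagram[OF assms] by (intro finite_PiE) auto
qed

text \<open>In a tableau \<open>T\<close> with entries at most \<open>M\<close>, the cells with entry less than \<open>M\<close> form an initial
  segment of each row; this is the column where it ends.\<close>

definition below_shape :: "(nat \<Rightarrow> nat) \<Rightarrow> (nat \<Rightarrow> nat) \<Rightarrow> nat \<Rightarrow> (nat \<times> nat \<Rightarrow> nat) \<Rightarrow> nat \<Rightarrow> nat" where
  "below_shape lam mu M T i = (LEAST j. mu i \<le> j \<and> (j < lam i \<longrightarrow> M \<le> T (i, j)))"

lemma below_shape_eqI:
  assumes "\<And>i. mu i \<le> nu i" "\<And>i. nu i \<le> lam i"
    and "\<And>i j. (i, j) \<in> diagram lam mu \<Longrightarrow> T (i, j) < M \<longleftrightarrow> j < nu i"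
  shows "below_shape lam mu M T = nu"
proof
  fix i
  show "below_shape lam mu M T i = nu i"
    unfolding below_shape_def
  proof (rule Least_equality)
    show "mu i \<le> nu i \<and> (nu i < lam i \<longrightarrow> M \<le> T (i, nu i))"
      using assms(1)[of i] assms(3)[of i "nu i"] by (auto simp: diagram_def not_less)
  next
    fix j assume j: "mu i \<le> j \<and> (j < lam i \<longrightarrow> M \<le> T (i, j))"
    show "nu i \<le> j"
    proof (rule ccontr)
      assume "\<not> nu i \<le> j"
      with j assms(2)[of i] have "(i, j) \<in> diagram lam mu" "j < nu i" "j < lam i"
        by (auto simp: diagram_def)
      with assms(3) j show False by fastforce
    qed
  qed
qed

lemma below_shape:
  assumes mu_lam: "mu \<le> lam" and T: "T \<in> tableaux lam mu (Suc M)"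
    and mu: "antimono mu" and lam: "antimono lam"
  defines "nu \<equiv> below_shape lam mu M T"
  shows "mu \<le> nu" and "nu \<in> interlacing lam"
    and "(i, j) \<in> diagram lam mu \<Longrightarrow> T (i, j) < M \<longleftrightarrow> j < nu i"
proof -
  let ?P = "\<lambda>i j. mu i \<le> j \<and> (j < lam i \<longrightarrow> M \<le> T (i, j))"
  have "?P i (lam i)" for i using mu_lam by (simp add: le_fun_def)
  then have nu: "?P i (nu i)" "nu i \<le> lam i" for i
    unfolding nu_def below_shape_def by (rule LeastI, rule Least_le)
  then show "mu \<le> nu" by (simp add: le_fun_def)
  show lt: "T (i, j) < M \<longleftrightarrow> j < nu i" if ij: "(i, j) \<in> diagram lam mu" for i j
  proof
    assume "j < nu i"
    then have "\<not> ?P i j" unfolding nu_def below_shape_def by (rule not_less_Least)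
    with ij show "T (i, j) < M" by (auto simp: diagram_def)
  next
    assume less: "T (i, j) < M"
    show "j < nu i"
    proof (rule ccontr)
      assume "\<not> j < nu i"
      with ij nu(1)[of i] have "(i, nu i) \<in> diagram lam mu" "nu i \<le> j" "M \<le> T (i, nu i)"
        by (auto simp: diagram_def)
      with T ij have "T (i, nu i) \<le> T (i, j)"
        by (cases "nu i = j") (auto simp: tableaux_def)
      with less \<open>M \<le> T (i, nu i)\<close> show False by simp
    qed
  qed
  \<comment> \<open>Otherwise some column would contain two entries that are at least \<open>M\<close>.\<close>
  have "lam (Suc i) \<le> nu i" for i
  proof (rule ccontr)
    assume "\<not> lam (Suc i) \<le> nu i"
    moreover have "lam (Suc i) \<le> lam i" "mu (Suc i) \<le> mu i"
      using lam mu by (auto simp: antimono_def)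
    ultimately have cells: "(i, nu i) \<in> diagram lam mu" "(Suc i, nu i) \<in> diagram lam mu"
      using nu(1)[of i] by (auto simp: diagram_def)
    with T have "T (i, nu i) < T (Suc i, nu i)" "T (Suc i, nu i) < Suc M"
      by (auto simp: tableaux_def PiE_def Pi_def)
    moreover have "M \<le> T (i, nu i)" using lt[OF cells(1)] by simp
    ultimately show False by simp
  qed
  with nu(2) show "nu \<in> interlacing lam" by (simp add: interlacing_def)
qed

text \<open>The branching rule. Removing the cells with the largest entry \<open>M\<close> leaves a tableau on a shape
  \<open>\<nu>/\<mu>\<close> with one variable less. Strictness in the columns says that the removed cells \<open>\<lambda>/\<nu>\<close> form a
  horizontal strip, and any tableau on \<open>\<nu>/\<mu>\<close> can be filled up with \<open>M\<close> again.\<close>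

lemma tableau_sum_Suc:
  assumes lam: "antimono lam" and L: "\<And>i. i \<ge> L \<Longrightarrow> lam i = 0"
    and mu: "antimono mu" and mu_lam: "mu \<le> lam"
  shows "tableau_sum x (Suc M) lam mu =
    (\<Sum>nu | nu \<in> interlacing lam \<and> mu \<le> nu.
      x M ^ (\<Sum>i<L. lam i - nu i) * tableau_sum x M nu mu)"
proof -
  define I where "I = {nu. nu \<in> interlacing lam \<and> mu \<le> nu}"
  let ?w = "\<lambda>nu T. \<Prod>c\<in>diagram nu mu. x (T c)"
  define fill where "fill nu T c = (if c \<in> diagram nu mu then T c
    else if c \<in> diagram lam mu then M else undefined)" for nu and T :: "nat \<times> nat \<Rightarrow> nat" and c
  have fin_I: "finite I"
    using finite_interlacing[OF L] by (simp add: I_def)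
  have nu_L: "nu i = 0" if "nu \<in> I" "i \<ge> L" for nu i
    using that L[of i] by (auto simp: I_def interlacing_def) (metis le_zero_eq)
  have nu_lam: "nu i \<le> lam i" "lam (Suc i) \<le> nu i" "mu i \<le> nu i" if "nu \<in> I" for nu i
    using that by (auto simp: I_def interlacing_def le_fun_def)
  have sub: "diagram nu mu \<subseteq> diagram lam mu" if "nu \<in> I" for nu
    using nu_lam[OF that] by (auto simp: diagram_def intro: less_le_trans)
  have fill: "fill nu T \<in> tableaux lam mu (Suc M)"
    "below_shape lam mu M (fill nu T) = nu" if nu: "nu \<in> I" and T: "T \<in> tableaux nu mu M" for nu T
  proof -
    have T_less: "T c < M" if "c \<in> diagram nu mu" for c
      using T that by (auto simp: tableaux_def)
    have up: "j < nu i" if "(i', j) \<in> diagram lam mu" "i < i'" for i i' j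
    proof -
      have "lam i' \<le> lam (Suc i)" using lam that(2) by (simp add: antimono_def)
      with nu_lam(2)[OF nu, of i] that(1) show ?thesis by (auto simp: diagram_def)
    qed
    show "fill nu T \<in> tableaux lam mu (Suc M)"
      unfolding tableaux_def
    proof (intro CollectI conjI allI impI)
      show "fill nu T \<in> diagram lam mu \<rightarrow>\<^sub>E {..<Suc M}"
        using T_less sub[OF nu] by (force simp: fill_def less_Suc_eq intro!: PiE_I)
      fix i j j' assume c: "(i, j) \<in> diagram lam mu" "(i, j') \<in> diagram lam mu" "j < j'"
      show "fill nu T (i, j) \<le> fill nu T (i, j')"
      proof (cases "(i, j') \<in> diagram nu mu")
        case True
        with c have "(i, j) \<in> diagram nu mu" by (auto simp: diagram_def)
        with True T c(3) show ?thesis by (auto simp: fill_def tableaux_def)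
      next
        case False
        with c T_less[of "(i, j)"] show ?thesis by (auto simp: fill_def intro: less_imp_le)
      qed
    next
      fix i i' j assume c: "(i, j) \<in> diagram lam mu" "(i', j) \<in> diagram lam mu" "i < i'"
      have ij: "(i, j) \<in> diagram nu mu" using up[OF c(2,3)] c(1) by (auto simp: diagram_def)
      show "fill nu T (i, j) < fill nu T (i', j)"
        using T c ij T_less[OF ij] by (auto simp: fill_def tableaux_def)
    qed
    show "below_shape lam mu M (fill nu T) = nu"
      by (rule below_shape_eqI)
        (use nu_lam[OF nu] T_less in \<open>auto simp: fill_def diagram_def\<close>)
  qed
  have weight: "(\<Prod>c\<in>diagram lam mu. x (fill nu T c)) = x M ^ (\<Sum>i<L. lam i - nu i) * ?w nu T"
    if nu: "nu \<in> I" for nu T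
  proof -
    have diff: "diagram lam mu - diagram nu mu = diagram lam nu"
      using nu_lam(3)[OF nu] by (auto simp: diagram_def not_less intro: order_trans)
    have "(\<Prod>c\<in>diagram lam mu. x (fill nu T c)) =
        (\<Prod>c\<in>diagram lam mu - diagram nu mu. x (fill nu T c)) * (\<Prod>c\<in>diagram nu mu. x (fill nu T c))"
      by (rule prod.subset_diff[OF sub[OF nu] finite_diagram[OF L]])
    also have "(\<Prod>c\<in>diagram nu mu. x (fill nu T c)) = ?w nu T" by (simp add: fill_def)
    also have "(\<Prod>c\<in>diagram lam mu - diagram nu mu. x (fill nu T c)) = x M ^ card (diagram lam nu)"
      by (simp add: fill_def diff[symmetric])
    also have "card (diagram lam nu) = (\<Sum>i<L. lam i - nu i)"
      by (subst diagram_eq_Sigma[OF L]) auto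
    finally show ?thesis .
  qed
  have "tableau_sum x (Suc M) lam mu =
      (\<Sum>(nu, T)\<in>(SIGMA nu:I. tableaux nu mu M). x M ^ (\<Sum>i<L. lam i - nu i) * ?w nu T)"
    unfolding tableau_sum_def
  proof (rule sum.reindex_bij_witness[of _ "\<lambda>(nu, T). fill nu T"
        "\<lambda>T. (below_shape lam mu M T, restrict T (diagram (below_shape lam mu M T) mu))"])
    fix T assume T: "T \<in> tableaux lam mu (Suc M)"
    let ?nu = "below_shape lam mu M T"
    note bs = below_shape[OF mu_lam T mu lam]
    have nu: "?nu \<in> I" using bs(1,2) by (simp add: I_def)
    have T_fill: "fill ?nu (restrict T (diagram ?nu mu)) = T"
    proof
      fix c :: "nat \<times> nat"
      obtain i j where c: "c = (i, j)" by (cases c)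
      show "fill ?nu (restrict T (diagram ?nu mu)) c = T c"
      proof (cases "c \<in> diagram lam mu - diagram ?nu mu")
        case True
        with c have "\<not> j < ?nu i" by (auto simp: diagram_def)
        with bs(3)[of i j] True c have "\<not> T c < M" by auto
        moreover have "T c < Suc M" using T True by (auto simp: tableaux_def)
        ultimately show ?thesis using True by (auto simp: fill_def)
      next
        case False
        with T sub[OF nu] show ?thesis unfolding c
          by (auto simp: fill_def tableaux_def PiE_def extensional_def)
      qed
    qed
    have "restrict T (diagram ?nu mu) \<in> tableaux ?nu mu M"
      unfolding tableaux_def
    proof (intro CollectI conjI allI impI)
      show "restrict T (diagram ?nu mu) \<in> diagram ?nu mu \<rightarrow>\<^sub>E {..<M}"
        unfolding restrict_PiE_iff
      proof
        fix c assume c: "c \<in> diagram ?nu mu"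
        obtain i j where ij: "c = (i, j)" by (cases c)
        with c sub[OF nu] have "(i, j) \<in> diagram lam mu" "j < ?nu i" by (auto simp: diagram_def)
        with bs(3) ij show "T c \<in> {..<M}" by simp
      qed
    qed (use T subsetD[OF sub[OF nu]] in \<open>simp_all add: tableaux_def\<close>)
    with nu T_fill weight[OF nu, of "restrict T (diagram ?nu mu)"]
    show "(case (?nu, restrict T (diagram ?nu mu)) of (v, T) \<Rightarrow> fill v T) = T"
      "(?nu, restrict T (diagram ?nu mu)) \<in> (SIGMA nu:I. tableaux nu mu M)"
      "(case (?nu, restrict T (diagram ?nu mu)) of (v, T) \<Rightarrow>
         x M ^ (\<Sum>i<L. lam i - v i) * ?w v T) = (\<Prod>c\<in>diagram lam mu. x (T c))"
      by simp_all
  next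
    fix p assume "p \<in> (SIGMA nu:I. tableaux nu mu M)"
    then obtain nu T where p: "p = (nu, T)" and nu: "nu \<in> I" and T: "T \<in> tableaux nu mu M" by auto
    have "restrict (fill nu T) (diagram nu mu) = T"
      using T by (auto simp: fun_eq_iff fill_def restrict_def tableaux_def PiE_def extensional_def)
    with fill[OF nu T] p
    show "(below_shape lam mu M (case p of (nu, T) \<Rightarrow> fill nu T),
        restrict (case p of (nu, T) \<Rightarrow> fill nu T)
          (diagram (below_shape lam mu M (case p of (nu, T) \<Rightarrow> fill nu T)) mu)) = p"
      "(case p of (nu, T) \<Rightarrow> fill nu T) \<in> tableaux lam mu (Suc M)"
      by simp_all
  qed
  also have "\<dots> = (\<Sum>nu\<in>I. x M ^ (\<Sum>i<L. lam i - nu i) * tableau_sum x M nu mu)"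
    using fin_I finite_tableaux[OF nu_L]
    by (subst sum.Sigma[symmetric]) (auto simp: tableau_sum_def sum_distrib_left)
  finally show ?thesis by (simp add: I_def)
qed

text \<open>Both sides satisfy the same branching rule in the number of variables. The case that \<open>\<mu>\<close> is not
  contained in \<open>\<lambda>\<close> belongs to the induction, because the rows of the matrix produce all horizontal
  strips \<open>\<lambda>/\<nu>\<close>, also those where \<open>\<nu>\<close> does not contain \<open>\<mu>\<close>.\<close>

theorem det_jacobi_trudi:
  fixes x :: "nat \<Rightarrow> 'a::comm_ring_1"
  assumes "antimono lam" and "\<And>i. i \<ge> L \<Longrightarrow> lam i = 0"
    and mu: "antimono mu" and mu_L: "\<And>i. i \<ge> L \<Longrightarrow> mu i = 0"
  shows "det (jacobi_trudi x M L lam mu) = (if mu \<le> lam then tableau_sum x M lam mu else 0)"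
  using assms(1,2)
proof (induction M arbitrary: lam)
  case (0 lam)
  have eq: "(\<forall>i<L. lam i = mu i) \<longleftrightarrow> mu = lam"
    using 0(2) mu_L by (auto simp: fun_eq_iff) (metis not_le)
  show ?case
  proof (cases "mu \<le> lam")
    case True
    have "tableau_sum x 0 lam mu = (if diagram lam mu = {} then 1 else 0)"
    proof (cases "diagram lam mu = {}")
      case True
      then have "tableaux lam mu 0 = {\<lambda>_. undefined}" by (auto simp: tableaux_def)
      with True show ?thesis by (simp add: tableau_sum_def)
    next
      case False
      then have "tableaux lam mu 0 = {}" by (auto simp: tableaux_def PiE_eq_empty_iff)
      with False show ?thesis by (simp add: tableau_sum_def)
    qed
    also have "diagram lam mu = {} \<longleftrightarrow> mu = lam"
    proof
      assume "diagram lam mu = {}"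
      then have "\<not> mu i < lam i" for i by (auto simp: diagram_def)
      then have "lam \<le> mu" by (simp add: le_fun_def not_less)
      with True show "mu = lam" by (rule antisym)
    qed (auto simp: diagram_def)
    finally show ?thesis
      using True by (simp only: det_jacobi_trudi_0[OF 0(1) mu] eq if_True)
  next
    case False
    then show ?thesis using det_jacobi_trudi_0[OF 0(1) mu, of x L] eq by auto
  qed
next
  case (Suc M lam)
  have nu: "antimono nu" "\<And>i. i \<ge> L \<Longrightarrow> nu i = 0" "nu \<le> lam" if "nu \<in> interlacing lam" for nu
  proof -
    have "nu (Suc i) \<le> nu i" for i
      using that by (auto simp: interlacing_def intro: order_trans)
    then show "antimono nu" by (simp add: antimono_iff_le_Suc)
    show "nu \<le> lam" using that by (simp add: interlacing_def le_fun_def)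
    then show "nu i = 0" if "i \<ge> L" for i using Suc.prems(2)[OF that] by (metis le_fun_def le_zero_eq)
  qed
  let ?t = "\<lambda>nu. x M ^ (\<Sum>i<L. lam i - nu i) * tableau_sum x M nu mu"
  have "det (jacobi_trudi x (Suc M) L lam mu) =
      (\<Sum>nu\<in>interlacing lam. if mu \<le> nu then ?t nu else 0)"
    by (subst det_jacobi_trudi_Suc[OF Suc.prems]) (auto simp: Suc.IH nu intro!: sum.cong)
  also have "\<dots> = (\<Sum>nu | nu \<in> interlacing lam \<and> mu \<le> nu. ?t nu)"
    using finite_interlacing[OF Suc.prems(2)] by (subst sum.inter_filter) auto
  also have "\<dots> = (if mu \<le> lam then tableau_sum x (Suc M) lam mu else 0)"
  proof (cases "mu \<le> lam")
    case True
    then show ?thesis using tableau_sum_Suc[OF Suc.prems mu True, where x = x and M = M] by simp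
  next
    case False
    then have "{nu. nu \<in> interlacing lam \<and> mu \<le> nu} = {}"
      using nu(3) by (auto dest: order_trans)
    with False show ?thesis by (simp only: sum.empty if_False)
  qed
  finally show ?case .
qed

section \<open>Expansion of a Schur function along a new first row\<close>

text \<open>Expand the Jacobi-Trudi determinant of \<open>(n, \<lambda>)\<close> along its first row, with entries \<open>h\<^sub>n\<^sub>+\<^sub>j\<close>.
  Deleting the first row lowers all indices by 1, and deleting column \<open>j\<close> raises them again in the
  columns to the right of it. What remains is a decrease by 1 in the first \<open>j\<close> columns, so the minor
  is the Jacobi-Trudi determinant of \<open>\<lambda>/(1\<^sup>j)\<close>.\<close>

lemma tableau_sum_first_row_expansion:
  fixes x :: "nat \<Rightarrow> 'a::comm_ring_1"
  assumes lam: "antimono lam" and t: "\<And>i. i \<ge> t \<Longrightarrow> lam i = 0"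
    and pos: "\<And>i. i < t \<Longrightarrow> lam i \<ge> 1" and n: "lam 0 \<le> n"
  shows "tableau_sum x M (case_nat n lam) (\<lambda>_. 0) =
    (\<Sum>j\<le>t. (-1) ^ j * complete_hom x M (n + j) *
      tableau_sum x M lam (\<lambda>i. if i < j then 1 else 0))"
proof -
  define A where "A = jacobi_trudi x M (Suc t) (case_nat n lam) (\<lambda>_. 0)"
  have A: "A \<in> carrier_mat (Suc t) (Suc t)" by (simp add: A_def jacobi_trudi_def)
  have anti: "antimono (case_nat n lam)"
    unfolding antimono_iff_le_Suc
    using lam n by (auto split: nat.split simp: antimono_iff_le_Suc)
  have "tableau_sum x M (case_nat n lam) (\<lambda>_. 0) = det A"
    unfolding A_def
    by (subst det_jacobi_trudi[OF anti]) (auto simp: antimono_def le_fun_def t split: nat.split)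
  also have "\<dots> = (\<Sum>j<Suc t. A $$ (0, j) * cofactor A 0 j)"
    by (rule laplace_expansion_row[OF A]) simp
  also have "\<dots> = (\<Sum>j\<le>t. (-1) ^ j * complete_hom x M (n + j) *
      tableau_sum x M lam (\<lambda>i. if i < j then 1 else 0))"
  proof (rule sum.cong)
    fix j assume "j \<in> {..t}"
    then have j: "j \<le> t" by simp
    let ?mu = "\<lambda>i. if i < j then 1 else 0 :: nat"
    have "A $$ (0, j) = complete_hom x M (n + j)"
      using j by (simp add: A_def jacobi_trudi_def complete_hom_int_def nat_add_distrib)
    moreover have "mat_delete A 0 j = jacobi_trudi x M t lam ?mu"
    proof (rule eq_matI)
      fix i c assume "i < dim_row (jacobi_trudi x M t lam ?mu)"
        "c < dim_col (jacobi_trudi x M t lam ?mu)"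
      then have ic: "i < t" "c < t" by (simp_all add: jacobi_trudi_def)
      have "mat_delete A 0 j $$ (i, c) = A $$ (Suc i, if c < j then c else Suc c)"
        using ic A by (simp add: mat_delete_def)
      also have "\<dots> = jacobi_trudi x M t lam ?mu $$ (i, c)"
        using ic by (auto simp: A_def jacobi_trudi_def intro!: arg_cong[where f = "complete_hom_int x M"])
      finally show "mat_delete A 0 j $$ (i, c) = jacobi_trudi x M t lam ?mu $$ (i, c)" .
    qed (use A in \<open>simp_all add: jacobi_trudi_def\<close>)
    moreover have "det (jacobi_trudi x M t lam ?mu) = tableau_sum x M lam ?mu"
      using pos j by (subst det_jacobi_trudi[OF lam t]) (auto simp: antimono_def le_fun_def)
    ultimately show "A $$ (0, j) * cofactor A 0 j =
        (-1) ^ j * complete_hom x M (n + j) * tableau_sum x M lam ?mu"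
      by (simp add: cofactor_def)
  qed auto
  finally show ?thesis .
qed

section \<open>Evaluation of polynomials\<close>

text \<open>An equality of symmetric functions, such as the hypothesis on a Frobenius characteristic, is
  used only through its values at complex points.\<close>

definition monomial_eval :: "(nat \<Rightarrow> complex) \<Rightarrow> (nat \<Rightarrow>\<^sub>0 nat) \<Rightarrow> complex" where
  "monomial_eval x e = (\<Prod>i\<in>Poly_Mapping.keys e. x i ^ Poly_Mapping.lookup e i)"

definition cpoly_eval :: "(nat \<Rightarrow> complex) \<Rightarrow> cpoly \<Rightarrow> complex" where
  "cpoly_eval x p = (\<Sum>e\<in>Poly_Mapping.keys p. Poly_Mapping.lookup p e * monomial_eval x e)"

lemma monomial_eval_superset:
  assumes "finite S" "Poly_Mapping.keys e \<subseteq> S"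
  shows "monomial_eval x e = (\<Prod>i\<in>S. x i ^ Poly_Mapping.lookup e i)"
  unfolding monomial_eval_def
  by (rule prod.mono_neutral_left) (use assms in \<open>auto simp: in_keys_iff\<close>)

lemma monomial_eval_add: "monomial_eval x (e + f) = monomial_eval x e * monomial_eval x f"
proof -
  let ?S = "Poly_Mapping.keys e \<union> Poly_Mapping.keys f"
  have "Poly_Mapping.keys (e + f) \<subseteq> ?S" by (rule Poly_Mapping.keys_add)
  then show ?thesis
    by (simp add: monomial_eval_superset[of ?S] lookup_add power_add prod.distrib)
qed

lemma cpoly_eval_superset:
  assumes "finite S" "Poly_Mapping.keys p \<subseteq> S"
  shows "cpoly_eval x p = (\<Sum>e\<in>S. Poly_Mapping.lookup p e * monomial_eval x e)"
  unfolding cpoly_eval_def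
  by (rule sum.mono_neutral_left) (use assms in \<open>auto simp: in_keys_iff\<close>)

lemma cpoly_eval_add: "cpoly_eval x (p + q) = cpoly_eval x p + cpoly_eval x q"
proof -
  let ?S = "Poly_Mapping.keys p \<union> Poly_Mapping.keys q"
  have "Poly_Mapping.keys (p + q) \<subseteq> ?S" by (rule Poly_Mapping.keys_add)
  then show ?thesis
    by (simp add: cpoly_eval_superset[of ?S] lookup_add algebra_simps sum.distrib)
qed

lemma cpoly_eval_0 [simp]: "cpoly_eval x 0 = 0"
  by (simp add: cpoly_eval_def)

lemma cpoly_eval_sum: "cpoly_eval x (\<Sum>a\<in>A. f a) = (\<Sum>a\<in>A. cpoly_eval x (f a))"
  by (induction A rule: infinite_finite_induct) (simp_all add: cpoly_eval_add)

lemma cpoly_eval_single [simp]: "cpoly_eval x (Poly_Mapping.single e c) = c * monomial_eval x e"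
  by (cases "c = 0") (simp_all add: cpoly_eval_def)

lemma sum_single_lookup: "(\<Sum>e\<in>Poly_Mapping.keys p. Poly_Mapping.single e (Poly_Mapping.lookup p e)) = p"
  by (rule poly_mapping_eqI) (auto simp: lookup_sum lookup_single when_def in_keys_iff)

lemma cpoly_eval_mult: "cpoly_eval x (p * q) = cpoly_eval x p * cpoly_eval x q"
proof -
  let ?s = "\<lambda>p. \<Sum>e\<in>Poly_Mapping.keys p. Poly_Mapping.single e (Poly_Mapping.lookup p e)"
  have "cpoly_eval x (p * q) = cpoly_eval x (?s p * ?s q)"
    by (simp only: sum_single_lookup)
  also have "\<dots> = (\<Sum>e\<in>Poly_Mapping.keys p. \<Sum>f\<in>Poly_Mapping.keys q.
      (Poly_Mapping.lookup p e * monomial_eval x e) * (Poly_Mapping.lookup q f * monomial_eval x f))"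
    by (simp add: sum_product cpoly_eval_sum mult_single monomial_eval_add mult_ac)
  also have "\<dots> = cpoly_eval x p * cpoly_eval x q"
    by (simp add: cpoly_eval_def sum_product)
  finally show ?thesis .
qed

lemma cpoly_eval_1 [simp]: "cpoly_eval x 1 = 1"
  using cpoly_eval_single[of x 0 1] by (simp add: monomial_eval_def del: cpoly_eval_single)

lemma cpoly_eval_const [simp]: "cpoly_eval x (cpoly_const c) = c"
  by (simp add: cpoly_const_def monomial_eval_def)

lemma cpoly_eval_var [simp]: "cpoly_eval x (cpoly_var i) = x i"
  by (simp add: cpoly_var_def monomial_eval_def)

lemma cpoly_eval_prod: "cpoly_eval x (\<Prod>a\<in>A. f a) = (\<Prod>a\<in>A. cpoly_eval x (f a))"
  by (induction A rule: infinite_finite_induct) (simp_all add: cpoly_eval_mult)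

lemma cpoly_eval_prod_mset: "cpoly_eval x (\<Prod>a\<in>#A. f a) = (\<Prod>a\<in>#A. cpoly_eval x (f a))"
  by (induction A) (simp_all add: cpoly_eval_mult)

lemma cpoly_eval_power: "cpoly_eval x (p ^ n) = cpoly_eval x p ^ n"
  by (induction n) (simp_all add: cpoly_eval_mult)

lemma cpoly_eval_power_sum: "cpoly_eval x (power_sum r M) = (\<Sum>i<M. x i ^ r)"
  by (simp add: power_sum_def cpoly_eval_sum cpoly_eval_power)

lemma cpoly_eval_skew_schur:
  "cpoly_eval x (skew_schur lam mu M) = tableau_sum x M (part lam) (part mu)"
  by (simp add: skew_schur_def tableau_sum_def ssyt_conv skew_diagram_conv cpoly_eval_sum
      cpoly_eval_prod)

lemma cpoly_eval_frobenius:
  "cpoly_eval x (frobenius_characteristic N \<chi> M) =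
    (\<Sum>w\<in>carrier (sym_group N). \<chi> w * (\<Prod>c\<in>#cycle_type N w. \<Sum>i<M. x i ^ c)) / fact N"
  by (simp add: frobenius_characteristic_def cpoly_eval_mult cpoly_eval_sum cpoly_eval_prod_mset
      cpoly_eval_power_sum)

section \<open>The cycle index of the symmetric group\<close>

lemma permutes_permutation: "finite A \<Longrightarrow> w permutes A \<Longrightarrow> permutation w"
  by (auto simp: permutation_permutes)

lemma orbit_eq_iff:
  assumes "permutation w"
  shows "orbit w a = orbit w b \<longleftrightarrow> a \<in> orbit w b"
  using permutation_self_in_orbit[OF assms] cyclic_on_orbit'[OF assms] orbit_cyclic_eq3 by metis

lemma orbit_fibre:
  assumes A: "finite A" and w: "w permutes A" and C: "C \<in> orbit w ` A"
  shows "{a \<in> A. orbit w a = C} = C"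
proof -
  note perm = permutes_permutation[OF A w]
  obtain c where c: "c \<in> A" "C = orbit w c" using C by blast
  have "orbit w c \<subseteq> A" by (rule permutes_orbit_subset[OF w c(1)])
  then show ?thesis unfolding c(2) orbit_eq_iff[OF perm] by blast
qed
text \<open>Multiplying out the product of power sums amounts to choosing a variable for each cycle, that
  is, a colouring of \<open>A\<close> that is constant on the cycles.\<close>

lemma prod_cycle_power_sums:
  fixes x :: "nat \<Rightarrow> 'a::comm_semiring_1"
  assumes A: "finite A" and w: "w permutes A"
  shows "(\<Prod>C\<in>orbit w ` A. \<Sum>i<M. x i ^ card C) =
    (\<Sum>f | f \<in> A \<rightarrow>\<^sub>E {..<M} \<and> (\<forall>a\<in>A. f (w a) = f a). \<Prod>a\<in>A. x (f a))"
proof -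
  note perm = permutes_permutation[OF A w]
  have self: "a \<in> orbit w a" for a by (rule permutation_self_in_orbit[OF perm])
  have sub: "orbit w a \<subseteq> A" if "a \<in> A" for a by (rule permutes_orbit_subset[OF w that])
  let ?F = "{f. f \<in> A \<rightarrow>\<^sub>E {..<M} \<and> (\<forall>a\<in>A. f (w a) = f a)}"
  let ?G = "orbit w ` A \<rightarrow>\<^sub>E {..<M}"
  \<comment> \<open>A colouring of the cycles becomes a colouring of their elements.\<close>
  let ?pull = "\<lambda>g. restrict (\<lambda>a. g (orbit w a)) A"
  have "bij_betw ?pull ?G ?F"
    unfolding bij_betw_def
  proof
    show "inj_on ?pull ?G"
    proof (rule inj_onI)
      fix g g' assume g: "g \<in> ?G" "g' \<in> ?G" and eq: "?pull g = ?pull g'"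
      show "g = g'"
      proof (rule PiE_ext[OF g])
        fix C assume "C \<in> orbit w ` A"
        then obtain a where "a \<in> A" "C = orbit w a" by auto
        with fun_cong[OF eq, of a] show "g C = g' C" by simp
      qed
    qed
    show "?pull ` ?G = ?F"
    proof (intro equalityI subsetI)
      fix f assume "f \<in> ?pull ` ?G"
      then obtain g where g: "g \<in> ?G" "f = ?pull g" by auto
      have "orbit w (w a) = orbit w a" for a
        by (simp add: orbit_eq_iff[OF perm] orbit.base)
      with g show "f \<in> ?F" using permutes_in_image[OF w] by auto
    next
      fix f assume f: "f \<in> ?F"
      have const: "f b = f a" if "b \<in> orbit w a" "a \<in> A" for a b
        using that(1)
      proof induction
        case base
        with f that(2) show ?case by simp
      next
        case (step b)
        with sub[OF that(2)] f show ?case by auto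
      qed
      define g where "g = restrict (\<lambda>C. the_elem (f ` C)) (orbit w ` A)"
      have g: "g (orbit w a) = f a" if "a \<in> A" for a
      proof -
        have "f ` orbit w a = (\<lambda>_. f a) ` orbit w a"
          by (rule image_cong[OF refl const[OF _ that]])
        also have "\<dots> = {f a}" using self[of a] by blast
        finally have "f ` orbit w a = {f a}" .
        with that show ?thesis by (simp add: g_def)
      qed
      have "g \<in> ?G"
      proof (rule PiE_I)
        fix C assume "C \<in> orbit w ` A"
        then obtain a where a: "a \<in> A" "C = orbit w a" by blast
        have "g C = f a" unfolding a(2) by (rule g[OF a(1)])
        with a(1) f show "g C \<in> {..<M}" by auto
      qed (simp add: g_def)
      moreover have "f = ?pull g"
      proof
        fix a show "f a = ?pull g a"
          using f g by (cases "a \<in> A") (auto simp: PiE_def extensional_def)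
      qed
      ultimately show "f \<in> ?pull ` ?G" by blast
    qed
  qed
  then have "(\<Sum>f\<in>?F. \<Prod>a\<in>A. x (f a)) = (\<Sum>g\<in>?G. \<Prod>a\<in>A. x (?pull g a))"
    by (rule sum.reindex_bij_betw[symmetric])
  also have "\<dots> = (\<Sum>g\<in>?G. \<Prod>C\<in>orbit w ` A. x (g C) ^ card C)"
  proof (rule sum.cong[OF refl])
    fix g
    have "(\<Prod>a\<in>A. x (?pull g a)) =
        (\<Prod>C\<in>orbit w ` A. \<Prod>a\<in>{a \<in> A. orbit w a = C}. x (?pull g a))"
      by (rule prod.image_gen[OF A])
    also have "\<dots> = (\<Prod>C\<in>orbit w ` A. x (g C) ^ card C)"
    proof (rule prod.cong[OF refl])
      fix C assume "C \<in> orbit w ` A"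
      then have "{a \<in> A. orbit w a = C} = C" by (rule orbit_fibre[OF A w])
      moreover have "(\<Prod>a\<in>{a \<in> A. orbit w a = C}. x (?pull g a)) =
          (\<Prod>a\<in>{a \<in> A. orbit w a = C}. x (g C))"
        by (rule prod.cong) auto
      ultimately show "(\<Prod>a\<in>{a \<in> A. orbit w a = C}. x (?pull g a)) = x (g C) ^ card C"
        by simp
    qed
    finally show "(\<Prod>a\<in>A. x (?pull g a)) = (\<Prod>C\<in>orbit w ` A. x (g C) ^ card C)" .
  qed
  also have "\<dots> = (\<Prod>C\<in>orbit w ` A. \<Sum>i<M. x i ^ card C)"
    using A by (intro prod_sum_PiE[symmetric]) auto
  finally show ?thesis by simp
qed

lemma ex_fun_image_mset:
  assumes "finite A" "size X = card A"
  shows "\<exists>f. image_mset f (mset_set A) = X"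
proof -
  obtain xs where xs: "mset xs = X" using ex_mset by blast
  obtain as where as: "set as = A" "distinct as" using finite_distinct_list[OF assms(1)] by blast
  have len: "length xs = length as" using xs as assms(2) distinct_card by force
  define f where "f a = the (map_of (zip as xs) a)" for a
  have "map f as = xs"
    using as(2) len by (intro nth_equalityI) (auto simp: f_def map_of_zip_nth)
  then have "image_mset f (mset as) = X" using xs by (metis mset_map)
  with as show ?thesis by (auto simp: mset_set_set)
qed

text \<open>The orbit-stabiliser theorem for the action on colourings of type \<open>X\<close>. For a fixed colouring \<open>f\<close>
  of this type, every permutation moves \<open>f\<close> to exactly one colouring \<open>g\<close> of this type, and those that
  move it to \<open>g\<close> form a coset of the stabiliser of \<open>g\<close>.\<close>

lemma sum_card_stabilizer:
  assumes A: "finite A" and X: "size X = card A" "set_mset X \<subseteq> B" and B: "finite B"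
  shows "(\<Sum>f | f \<in> A \<rightarrow>\<^sub>E B \<and> image_mset f (mset_set A) = X.
    card {w. w permutes A \<and> (\<forall>a\<in>A. f (w a) = f a)}) = fact (card A)"
proof -
  let ?F = "{f. f \<in> A \<rightarrow>\<^sub>E B \<and> image_mset f (mset_set A) = X}"
  obtain f where f: "image_mset f (mset_set A) = X"
    using ex_fun_image_mset[OF A X(1)] by blast
  let ?W = "\<lambda>g. {w. w permutes A \<and> (\<forall>a\<in>A. f (w a) = g a)}"
  have fin: "finite ?F" using finite_PiE[OF A, of "\<lambda>_. B"] B by (auto intro: rev_finite_subset)
  have finW: "finite (?W g)" for g
    using finite_permutations[OF A] by (auto intro: rev_finite_subset)
  have stab: "card {w. w permutes A \<and> (\<forall>a\<in>A. g (w a) = g a)} = card (?W g)" if g: "g \<in> ?F" for g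
  proof -
    have "image_mset g (mset_set A) = image_mset f (mset_set A)" using g f by simp
    then obtain p where p: "p permutes A" "\<forall>a\<in>A. g a = f (p a)"
      using image_mset_eq_implies_permutes[OF A] by metis
    have "bij_betw (\<lambda>u. p \<circ> u) {w. w permutes A \<and> (\<forall>a\<in>A. g (w a) = g a)} (?W g)"
    proof (rule bij_betw_byWitness[where f' = "\<lambda>w. inv' p \<circ> w"])
      show "\<forall>u\<in>{w. w permutes A \<and> (\<forall>a\<in>A. g (w a) = g a)}. inv' p \<circ> (p \<circ> u) = u"
        using permutes_inv_o(2)[OF p(1)] by (simp add: o_assoc)
      show "\<forall>w\<in>?W g. p \<circ> (inv' p \<circ> w) = w"
        using permutes_inv_o(1)[OF p(1)] by (simp add: o_assoc)
      show "(\<circ>) p ` {w. w permutes A \<and> (\<forall>a\<in>A. g (w a) = g a)} \<subseteq> ?W g"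
        using p by (auto simp: permutes_compose permutes_in_image)
      show "(\<circ>) (inv' p) ` ?W g \<subseteq> {w. w permutes A \<and> (\<forall>a\<in>A. g (w a) = g a)}"
      proof safe
        fix w assume w: "w permutes A" "\<forall>a\<in>A. f (w a) = g a"
        show "inv' p \<circ> w permutes A" by (rule permutes_compose[OF w(1) permutes_inv[OF p(1)]])
        fix a assume a: "a \<in> A"
        then have "inv' p (w a) \<in> A" using permutes_in_image[OF permutes_inv[OF p(1)]] w(1)
          by (simp add: permutes_in_image)
        with p have "g (inv' p (w a)) = f (p (inv' p (w a)))" by blast
        also have "\<dots> = g a" using w a by (simp add: permutes_inverses(1)[OF p(1)])
        finally show "g ((inv' p \<circ> w) a) = g a" by simp
      qed
    qed
    then show ?thesis by (rule bij_betw_same_card)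
  qed
  have "(\<Sum>g\<in>?F. card {w. w permutes A \<and> (\<forall>a\<in>A. g (w a) = g a)}) = (\<Sum>g\<in>?F. card (?W g))"
    using stab by (intro sum.cong) auto
  also have "\<dots> = card (\<Union>g\<in>?F. ?W g)"
  proof (rule card_UN_disjoint[symmetric, OF fin])
    show "\<forall>g\<in>?F. \<forall>g'\<in>?F. g \<noteq> g' \<longrightarrow> ?W g \<inter> ?W g' = {}"
    proof (intro ballI impI, rule ccontr)
      fix g g' assume g: "g \<in> ?F" "g' \<in> ?F" and neq: "g \<noteq> g'" and "?W g \<inter> ?W g' \<noteq> {}"
      then obtain w where "\<forall>a\<in>A. g a = g' a" by force
      with g have "g = g'" by (intro PiE_ext[of g A _ g']) auto
      with neq show False ..
    qed
  qed (use finW in blast)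
  also have "(\<Union>g\<in>?F. ?W g) = {w. w permutes A}"
  proof (intro equalityI subsetI)
    fix w assume "w \<in> {w. w permutes A}"
    then have w: "w permutes A" by simp
    let ?g = "restrict (f \<circ> w) A"
    have "image_mset ?g (mset_set A) = image_mset (f \<circ> w) (mset_set A)"
      using A by (intro image_mset_cong) auto
    also have "\<dots> = image_mset f (image_mset w (mset_set A))" by (simp add: multiset.map_comp)
    also have "image_mset w (mset_set A) = mset_set A"
      using image_mset_mset_set[OF permutes_inj_on[OF w], of A] permutes_image[OF w] by simp
    also note f
    finally have g: "image_mset ?g (mset_set A) = X" .
    have "f a \<in> B" if "a \<in> A" for a
      using that A f X(2) by (metis finite_set_mset_mset_set imageI set_image_mset subsetD)
    then have "?g \<in> A \<rightarrow>\<^sub>E B" using permutes_in_image[OF w] by auto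
    with g have "?g \<in> ?F" by blast
    moreover have "w \<in> ?W ?g" using w by simp
    ultimately show "w \<in> (\<Union>g\<in>?F. ?W g)" by blast
  qed auto
  also have "card \<dots> = fact (card A)" by (rule card_permutations[OF refl A])
  finally show ?thesis .
qed

text \<open>The Frobenius characteristic of the trivial character is a complete homogeneous symmetric
  function. Counting pairs of a permutation and a colouring that it preserves, each monomial of
  degree \<open>N\<close> occurs \<open>N!\<close> times by the orbit-stabiliser theorem. At roots of unity the identity
  determines the number of permutations of cycle type \<open>r\<^sup>m\<close>.\<close>

theorem cycle_index_eq_complete_hom:
  fixes x :: "nat \<Rightarrow> 'a::{comm_semiring_1,semiring_char_0}"
  assumes A: "finite A"
  shows "(\<Sum>w | w permutes A. \<Prod>C\<in>orbit w ` A. \<Sum>i<M. x i ^ card C) =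
    fact (card A) * complete_hom x M (card A)"
proof -
  let ?E = "A \<rightarrow>\<^sub>E {..<M}" and ?fix = "\<lambda>f w. \<forall>a\<in>A. f (w a) = f a"
  let ?type = "\<lambda>f. image_mset f (mset_set A)"
  have finE: "finite ?E" using A by (intro finite_PiE) auto
  have finP: "finite {w. w permutes A}" by (rule finite_permutations[OF A])
  have "(\<Sum>w | w permutes A. \<Prod>C\<in>orbit w ` A. \<Sum>i<M. x i ^ card C) =
      (\<Sum>w | w permutes A. \<Sum>f\<in>?E. if ?fix f w then \<Prod>a\<in>A. x (f a) else 0)"
    using finE by (intro sum.cong) (auto simp: prod_cycle_power_sums[OF A] sum.inter_filter)
  also have "\<dots> = (\<Sum>f\<in>?E. \<Sum>w | w permutes A. if ?fix f w then \<Prod>a\<in>A. x (f a) else 0)"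
    by (rule sum.swap)
  also have "\<dots> = (\<Sum>f\<in>?E. of_nat (card {w. w permutes A \<and> ?fix f w}) * (\<Prod>i\<in>#?type f. x i))"
  proof (rule sum.cong[OF refl])
    fix f
    have "(\<Sum>w | w permutes A. if ?fix f w then \<Prod>a\<in>A. x (f a) else 0) =
        (\<Sum>w | w permutes A \<and> ?fix f w. \<Prod>a\<in>A. x (f a))"
      using finP by (subst sum.inter_filter[symmetric]) auto
    then show "(\<Sum>w | w permutes A. if ?fix f w then \<Prod>a\<in>A. x (f a) else 0) =
        of_nat (card {w. w permutes A \<and> ?fix f w}) * (\<Prod>i\<in>#?type f. x i)"
      by (simp add: prod_unfold_prod_mset multiset.map_comp comp_def)
  qed
  also have "\<dots> = (\<Sum>X\<in>multisets_below M (card A). \<Sum>f | f \<in> ?E \<and> ?type f = X.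
      of_nat (card {w. w permutes A \<and> ?fix f w}) * (\<Prod>i\<in>#?type f. x i))"
  proof (rule sum.group[symmetric, OF finE finite_multisets_below])
    show "?type ` ?E \<subseteq> multisets_below M (card A)"
      using A by (auto simp: multisets_below_def)
  qed
  also have "\<dots> = (\<Sum>X\<in>multisets_below M (card A). fact (card A) * (\<Prod>i\<in>#X. x i))"
  proof (rule sum.cong[OF refl])
    fix X assume X: "X \<in> multisets_below M (card A)"
    have "(\<Sum>f | f \<in> ?E \<and> ?type f = X.
        of_nat (card {w. w permutes A \<and> ?fix f w}) * (\<Prod>i\<in>#?type f. x i)) =
      of_nat (\<Sum>f | f \<in> ?E \<and> ?type f = X. card {w. w permutes A \<and> ?fix f w}) * (\<Prod>i\<in>#X. x i)"
      by (simp add: sum_distrib_right)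
    also have "(\<Sum>f | f \<in> ?E \<and> ?type f = X. card {w. w permutes A \<and> ?fix f w}) = fact (card A)"
      using X by (intro sum_card_stabilizer[OF A]) (auto simp: multisets_below_def)
    finally show "(\<Sum>f | f \<in> ?E \<and> ?type f = X.
        of_nat (card {w. w permutes A \<and> ?fix f w}) * (\<Prod>i\<in>#?type f. x i)) =
      fact (card A) * (\<Prod>i\<in>#X. x i)" by simp
  qed
  finally show ?thesis by (simp add: complete_hom_def sum_distrib_left)
qed

section \<open>Characters on permutations with cycles of equal length\<close>

lemma orbit_funpow:
  assumes "permutation w" "card (orbit w a) = r"
  shows "bij_betw (\<lambda>i. (w ^^ i) a) {..<r} (orbit w a)" and "(w ^^ r) a = a"
proof -
  have self: "a \<in> orbit w a" by (rule permutation_self_in_orbit[OF assms(1)])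
  define d where "d = funpow_dist1 w a a"
  have bij: "bij_betw (\<lambda>i. (w ^^ i) a) {0..<d} (orbit w a)"
    unfolding d_def bij_betw_def
    using inj_on_funpow_dist1[OF self] orbit_conv_funpow_dist1[OF self] by simp
  then have "d = r" using assms(2) bij_betw_same_card by fastforce
  with bij show "bij_betw (\<lambda>i. (w ^^ i) a) {..<r} (orbit w a)" by (simp add: atLeast0LessThan)
  show "(w ^^ r) a = a"
    using funpow_dist1_prop[OF self] \<open>d = r\<close> unfolding d_def by simp
qed

text \<open>A coordinate system: the cycles are numbered by \<open>b < m\<close>, and \<open>i < r\<close> counts steps along a cycle from
  a chosen starting point. In these coordinates every such permutation is the same cyclic shift,
  so two of them are conjugate by a change of coordinates.\<close>

lemma cycle_frame:
  assumes A: "finite A" and w: "w permutes A" and m: "card (orbit w ` A) = m"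
    and r: "\<And>a. a \<in> A \<Longrightarrow> card (orbit w a) = r"
  obtains e where "bij_betw e ({..<m} \<times> {..<r}) A"
    and "\<And>b i. b < m \<Longrightarrow> i < r \<Longrightarrow> w (e (b, i)) = e (b, Suc i mod r)"
proof -
  note perm = permutes_permutation[OF A w]
  note eq_iff = orbit_eq_iff[OF perm]
  have self: "a \<in> orbit w a" for a by (rule permutation_self_in_orbit[OF perm])
  obtain C where C: "bij_betw C {..<m} (orbit w ` A)"
    using ex_bij_betw_nat_finite[of "orbit w ` A"] A m by (auto simp: atLeast0LessThan)
  define s where "s b = (SOME a. a \<in> A \<and> orbit w a = C b)" for b
  have s: "s b \<in> A" "orbit w (s b) = C b" if "b < m" for b
  proof -
    have "C b \<in> orbit w ` A" using C that by (auto simp: bij_betw_def)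
    then have "\<exists>a. a \<in> A \<and> orbit w a = C b" by auto
    then have "s b \<in> A \<and> orbit w (s b) = C b" unfolding s_def by (rule someI_ex)
    then show "s b \<in> A" "orbit w (s b) = C b" by simp_all
  qed
  have bij: "bij_betw (\<lambda>i. (w ^^ i) (s b)) {..<r} (C b)" and per: "(w ^^ r) (s b) = s b"
    if "b < m" for b
    using orbit_funpow[OF perm r[OF s(1)[OF that]]] s(2)[OF that] by simp_all
  define e where "e = (\<lambda>(b, i). (w ^^ i) (s b))"
  have e_in: "e (b, i) \<in> C b" if "b < m" "i < r" for b i
    using bij[OF that(1)] that(2) by (auto simp: e_def bij_betw_def)
  show ?thesis
  proof (rule that)
    show "bij_betw e ({..<m} \<times> {..<r}) A"
      unfolding bij_betw_def
    proof
      show "inj_on e ({..<m} \<times> {..<r})"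
      proof (rule inj_onI)
        fix p q assume pq: "p \<in> {..<m} \<times> {..<r}" "q \<in> {..<m} \<times> {..<r}" "e p = e q"
        obtain b i b' i' where p: "p = (b, i)" and q: "q = (b', i')" by (metis surj_pair)
        with pq have lt: "b \<in> {..<m}" "i \<in> {..<r}" "b' \<in> {..<m}" "i' \<in> {..<r}"
          and eq: "e (b, i) = e (b', i')" by auto
        then have "e (b, i) \<in> C b" "e (b, i) \<in> C b'" using e_in[of b i] e_in[of b' i'] by auto
        then have "C b = C b'" using s[of b] s[of b'] lt eq_iff by (metis lessThan_iff)
        then have b: "b = b'" using C lt by (auto simp: bij_betw_def inj_on_def)
        have "inj_on (\<lambda>i. (w ^^ i) (s b)) {..<r}" using bij lt by (auto simp: bij_betw_def)
        with eq lt b show "p = q" unfolding p q by (auto simp: e_def inj_on_def)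
      qed
      show "e ` ({..<m} \<times> {..<r}) = A"
      proof (intro equalityI subsetI)
        fix a assume "a \<in> e ` ({..<m} \<times> {..<r})"
        then obtain b i where "b < m" "i < r" "a = e (b, i)" by auto
        then have "a \<in> orbit w (s b)" "s b \<in> A" using e_in s by auto
        then show "a \<in> A" using permutes_orbit_subset[OF w] by blast
      next
        fix a assume "a \<in> A"
        then obtain b where b: "b < m" "orbit w a = C b"
          using C by (metis bij_betw_def imageE imageI lessThan_iff)
        then have "a \<in> C b" using self by metis
        then obtain i where "i < r" "a = (w ^^ i) (s b)" using bij[OF b(1)] by (auto simp: bij_betw_def)
        with b(1) show "a \<in> e ` ({..<m} \<times> {..<r})" by (auto simp: e_def intro!: image_eqI[of _ _ "(b, i)"])
      qed
    qed
    fix b i assume "b < m" "i < r"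
    show "w (e (b, i)) = e (b, Suc i mod r)"
    proof (cases "Suc i = r")
      case True
      with per[OF \<open>b < m\<close>] show ?thesis by (auto simp: e_def)
    next
      case False
      with \<open>i < r\<close> show ?thesis by (simp add: e_def)
    qed
  qed
qed

lemma conjugate_if_all_cycles_of_length:
  assumes A: "finite A" and w: "w permutes A" and w': "w' permutes A"
    and m: "card (orbit w ` A) = m" "card (orbit w' ` A) = m"
    and r: "\<And>a. a \<in> A \<Longrightarrow> card (orbit w a) = r" "\<And>a. a \<in> A \<Longrightarrow> card (orbit w' a) = r"
  obtains u where "u permutes A" "u \<circ> w = w' \<circ> u"
proof -
  let ?I = "{..<m} \<times> {..<r}"
  obtain e where e: "bij_betw e ?I A"
    "\<And>b i. b < m \<Longrightarrow> i < r \<Longrightarrow> w (e (b, i)) = e (b, Suc i mod r)"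
    using cycle_frame[OF A w m(1) r(1)] by metis
  obtain e' where e': "bij_betw e' ?I A"
    "\<And>b i. b < m \<Longrightarrow> i < r \<Longrightarrow> w' (e' (b, i)) = e' (b, Suc i mod r)"
    using cycle_frame[OF A w' m(2) r(2)] by metis
  define u where "u a = (if a \<in> A then e' (inv_into ?I e a) else a)" for a
  have u_e: "u (e p) = e' p" if "p \<in> ?I" for p
    using that e(1) by (auto simp: u_def bij_betw_def)
  have "bij_betw (e' \<circ> inv_into ?I e) A A"
    using bij_betw_trans[OF bij_betw_inv_into[OF e(1)] e'(1)] .
  then have "bij_betw u A A"
    by (subst bij_betw_cong[where g = "e' \<circ> inv_into ?I e"]) (auto simp: u_def)
  then have u: "u permutes A" by (rule bij_imp_permutes) (simp add: u_def)
  have "u (w a) = w' (u a)" for a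
  proof (cases "a \<in> A")
    case True
    then obtain b i where bi: "b < m" "i < r" "a = e (b, i)"
      using e(1) by (auto simp: bij_betw_def)
    then have "(b, Suc i mod r) \<in> ?I" by simp
    with bi show ?thesis by (simp add: e(2) e'(2) u_e)
  next
    case False
    then show ?thesis using w w' by (simp add: u_def permutes_not_in)
  qed
  with u that show ?thesis by (auto simp: fun_eq_iff)
qed

lemma trace_mult_commute:
  fixes A B :: "'a::comm_semiring_0 mat"
  assumes "A \<in> carrier_mat d d" "B \<in> carrier_mat d d"
  shows "(\<Sum>i<d. (A * B) $$ (i, i)) = (\<Sum>i<d. (B * A) $$ (i, i))"
proof -
  have "(\<Sum>i<d. (A * B) $$ (i, i)) = (\<Sum>i<d. \<Sum>j<d. A $$ (i, j) * B $$ (j, i))"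
    using assms by (simp add: scalar_prod_def atLeast0LessThan)
  also have "\<dots> = (\<Sum>j<d. \<Sum>i<d. B $$ (j, i) * A $$ (i, j))"
    by (subst sum.swap) (simp add: mult.commute)
  also have "\<dots> = (\<Sum>j<d. (B * A) $$ (j, j))"
    using assms by (simp add: scalar_prod_def atLeast0LessThan)
  finally show ?thesis .
qed

text \<open>The trace is invariant under cyclic rotation of a product.\<close>

lemma is_character_conjugate:
  assumes "is_character N \<chi>" and w: "w permutes {1..N}" and w': "w' permutes {1..N}"
    and u: "u permutes {1..N}" and conj: "u \<circ> w = w' \<circ> u"
  shows "\<chi> w' = \<chi> w"
proof -
  obtain d \<rho> where rep: "representation N d \<rho>" and aff: "affords N d \<rho> \<chi>"
    using assms(1) by (auto simp: is_character_def)
  have \<rho>: "\<rho> p \<in> carrier_mat d d" if "p permutes {1..N}" for p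
    using rep that
    by (auto simp: representation_def hom_def sym_group_def units_of_def Units_def ring_mat_simps)
  have mult: "\<rho> (p \<circ> q) = \<rho> p * \<rho> q" if "p permutes {1..N}" "q permutes {1..N}" for p q
    using rep that
    by (auto simp: representation_def hom_def sym_group_def units_of_def ring_mat_simps)
  have \<chi>: "\<chi> p = (\<Sum>i<d. \<rho> p $$ (i, i))" if "p permutes {1..N}" for p
    using aff that by (simp add: affords_def sym_group_def)
  let ?v = "w \<circ> inv' u"
  have v: "?v permutes {1..N}" by (rule permutes_compose[OF permutes_inv[OF u] w])
  have "w' = u \<circ> ?v"
    using conj permutes_inv_o(1)[OF u] by (metis comp_assoc comp_id)
  moreover have "w = ?v \<circ> u"
    using permutes_inv_o(2)[OF u] by (metis comp_assoc comp_id)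
  ultimately show ?thesis
    using \<chi>[OF w] \<chi>[OF w'] mult[OF u v] mult[OF v u] trace_mult_commute[OF \<rho>[OF u] \<rho>[OF v]]
    by metis
qed

lemma cycle_type_replicate:
  assumes "cycle_type N w = replicate_mset m r"
  shows "card (orbit w ` {1..N}) = m" and "a \<in> {1..N} \<Longrightarrow> card (orbit w a) = r"
proof -
  have "size (cycle_type N w) = m" using assms by simp
  then show "card (orbit w ` {1..N}) = m" by (simp add: cycle_type_def)
  assume "a \<in> {1..N}"
  then have "card (orbit w a) \<in># cycle_type N w" by (simp add: cycle_type_def)
  then show "card (orbit w a) = r" using assms by (simp split: if_splits)
qed

text \<open>All permutations of this cycle type are conjugate, so the choice in \<^const>\<open>character_value\<close> does
  not matter.\<close>

lemma is_character_eq_character_value: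
  assumes \<chi>: "is_character N \<chi>" and w: "w \<in> carrier (sym_group N)"
    and type: "cycle_type N w = replicate_mset m r"
  shows "\<chi> w = character_value N \<chi> (replicate_mset m r)"
proof -
  define v where "v = (SOME w. w \<in> carrier (sym_group N) \<and> cycle_type N w = replicate_mset m r)"
  have "v \<in> carrier (sym_group N) \<and> cycle_type N v = replicate_mset m r"
    unfolding v_def by (rule someI[of _ w]) (use w type in simp)
  then have v: "v permutes {1..N}" "cycle_type N v = replicate_mset m r"
    by (simp_all add: sym_group_def)
  have w': "w permutes {1..N}" using w by (simp add: sym_group_def)
  obtain u where "u permutes {1..N}" "u \<circ> v = w \<circ> u"
    using conjugate_if_all_cycles_of_length[OF _ v(1) w'
        cycle_type_replicate(1)[OF v(2)] cycle_type_replicate(1)[OF type]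
        cycle_type_replicate(2)[OF v(2)] cycle_type_replicate(2)[OF type]]
    by (metis finite_atLeastAtMost)
  then have "\<chi> w = \<chi> v" by (rule is_character_conjugate[OF \<chi> v(1) w'])
  then show ?thesis by (simp add: character_value_def v_def)
qed

lemma sum_mset_cycle_type:
  assumes "w \<in> carrier (sym_group N)"
  shows "sum_mset (cycle_type N w) = N" and "0 \<notin># cycle_type N w"
proof -
  have w: "w permutes {1..N}" using assms by (simp add: sym_group_def)
  note perm = permutes_permutation[OF finite_atLeastAtMost w]
  have sub: "orbit w a \<subseteq> {1..N}" if "a \<in> {1..N}" for a by (rule permutes_orbit_subset[OF w that])
  have self: "a \<in> orbit w a" for a by (rule permutation_self_in_orbit[OF perm])
  have "sum_mset (cycle_type N w) = (\<Sum>C\<in>orbit w ` {1..N}. card C)"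
    by (simp add: cycle_type_def sum_unfold_sum_mset)
  also have "\<dots> = (\<Sum>C\<in>orbit w ` {1..N}. card {a \<in> {1..N}. orbit w a = C})"
    by (rule sum.cong[OF refl]) (simp only: orbit_fibre[OF finite_atLeastAtMost w])
  also have "\<dots> = (\<Sum>C\<in>orbit w ` {1..N}. \<Sum>a | a \<in> {1..N} \<and> orbit w a = C. 1)" by simp
  also have "\<dots> = (\<Sum>a\<in>{1..N}. 1)"
    by (rule sum.image_gen[symmetric]) simp
  finally show "sum_mset (cycle_type N w) = N" by simp
  have "card (orbit w a) \<noteq> 0" if "a \<in> {1..N}" for a
    using self[of a] finite_subset[OF sub[OF that]] by auto
  then show "0 \<notin># cycle_type N w" unfolding cycle_type_def by fastforce
qed

section \<open>Roots of unity\<close>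

definition unity_root :: "nat \<Rightarrow> complex" where
  "unity_root r = cis (2 * pi / real r)"

lemma unity_root_power: "unity_root r ^ i = cis (2 * pi * real i / real r)"
  by (simp add: unity_root_def DeMoivre mult.commute)

lemma unity_root_power_self: "r > 0 \<Longrightarrow> unity_root r ^ r = 1"
  by (simp add: unity_root_power)

lemma unity_root_power_eq_1_iff:
  assumes r: "r > 0"
  shows "unity_root r ^ c = 1 \<longleftrightarrow> r dvd c"
proof -
  have inj: "inj_on (\<lambda>i. unity_root r ^ i) {..<r}"
    using bij_betw_roots_unity[OF r] by (simp add: unity_root_power bij_betw_def)
  have "unity_root r ^ c = unity_root r ^ (r * (c div r) + c mod r)" by simp
  also have "\<dots> = unity_root r ^ (c mod r)"
    by (simp only: power_add power_mult unity_root_power_self[OF r] power_one mult_1)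
  finally have "unity_root r ^ c = 1 \<longleftrightarrow> unity_root r ^ (c mod r) = unity_root r ^ 0" by simp
  also have "\<dots> \<longleftrightarrow> c mod r = 0" using inj_on_eq_iff[OF inj, of "c mod r" 0] r by simp
  finally show ?thesis by (simp add: dvd_eq_mod_eq_0)
qed

lemma power_sum_unity_roots:
  assumes r: "r > 0"
  shows "(\<Sum>i<r * s. (unity_root r ^ i) ^ c) = (if r dvd c then of_nat (r * s) else 0)"
proof -
  have "(\<Sum>i<r * s. (unity_root r ^ i) ^ c) = (\<Sum>i<r * s. (unity_root r ^ c) ^ i)"
    by (simp add: power_mult[symmetric] mult.commute)
  also have "\<dots> = (if r dvd c then of_nat (r * s) else 0)"
  proof (cases "r dvd c")
    case True
    then have "unity_root r ^ c = 1" by (simp add: unity_root_power_eq_1_iff[OF r])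
    with True show ?thesis by simp
  next
    case False
    have "(unity_root r ^ c) ^ (r * s) = (unity_root r ^ r) ^ (c * s)"
      by (simp add: power_mult[symmetric] mult_ac)
    also have "\<dots> = 1" by (simp add: unity_root_power_self[OF r])
    finally show ?thesis
      using False geometric_sum[of "unity_root r ^ c" "r * s"]
      by (simp add: unity_root_power_eq_1_iff[OF r])
  qed
  finally show ?thesis .
qed

text \<open>Both sides have degree at most \<open>r\<close> and agree at 0 and at the \<open>r\<close> roots of unity.\<close>

lemma prod_one_minus_unity_roots:
  assumes r: "r > 0"
  shows "(\<Prod>i<r. 1 - fps_const (unity_root r ^ i) * fps_X) = 1 - fps_X ^ r"
proof -
  let ?p = "\<Prod>i<r. [:1, - (unity_root r ^ i):]" and ?q = "1 - monom 1 r :: complex poly"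
  have "?p = ?q"
  proof (rule poly_eqI_degree[where A = "insert 0 {z. z ^ r = 1}"])
    fix z :: complex assume "z \<in> insert 0 {z. z ^ r = 1}"
    then consider "z = 0" | "z ^ r = 1" by auto
    then show "poly ?p z = poly ?q z"
    proof cases
      case 1
      with r show ?thesis by (simp add: poly_prod poly_monom)
    next
      case 2
      then have "z \<noteq> 0" using r by (auto simp: power_0_left)
      have "inverse z \<in> {z. z ^ r = 1}" using 2 by (simp add: power_inverse)
      also have "{z. z ^ r = 1} = (\<lambda>i. unity_root r ^ i) ` {..<r}"
        using bij_betw_roots_unity[OF r] by (simp add: unity_root_power bij_betw_def)
      finally obtain i where i: "i < r" "unity_root r ^ i = inverse z" by auto
      have "\<exists>i\<in>{..<r}. 1 + z * - (unity_root r ^ i) = 0"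
        using i \<open>z \<noteq> 0\<close> by (intro bexI[of _ i]) auto
      then have "poly ?p z = 0" unfolding poly_prod by (intro prod_zero) auto
      with 2 show ?thesis by (simp add: poly_monom)
    qed
  next
    have card: "card (insert 0 {z::complex. z ^ r = 1}) = Suc r"
      using r by (subst card_insert_disjoint) (auto simp: card_roots_unity_eq finite_roots_unity power_0_left)
    have "degree ?p \<le> sum (degree \<circ> (\<lambda>i. [:1, - (unity_root r ^ i):])) {..<r}"
      by (rule degree_prod_sum_le) simp
    also have "\<dots> \<le> r" by (rule order_trans[OF sum_bounded_above[where K = 1]]) auto
    finally show "degree ?p < card (insert 0 {z::complex. z ^ r = 1})" unfolding card by simp
    have "degree ?q \<le> r" by (rule degree_diff_le) (auto simp: degree_monom_le)
    then show "degree ?q < card (insert 0 {z::complex. z ^ r = 1})" unfolding card by simp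
  qed
  then have "fps_of_poly ?p = fps_of_poly ?q" by simp
  then show ?thesis
    by (simp add: fps_of_poly_prod fps_of_poly_diff fps_of_poly_monom fps_of_poly_pCons mult.commute
        fps_const_neg[symmetric] del: fps_const_neg)
qed

text \<open>The classical generating function, cleared of denominators.\<close>

lemma complete_hom_fps:
  fixes x :: "nat \<Rightarrow> 'a::comm_ring_1"
  shows "Abs_fps (complete_hom x M) * (\<Prod>i<M. 1 - fps_const (x i) * fps_X) = 1"
proof (induction M)
  case 0
  show ?case by (rule fps_ext) (simp add: complete_hom_0_left)
next
  case (Suc M)
  have "Abs_fps (complete_hom x (Suc M)) * (1 - fps_const (x M) * fps_X) = Abs_fps (complete_hom x M)"
  proof (rule fps_ext)
    fix d
    show "fps_nth (Abs_fps (complete_hom x (Suc M)) * (1 - fps_const (x M) * fps_X)) d =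
        fps_nth (Abs_fps (complete_hom x M)) d"
      by (cases d) (simp_all add: algebra_simps complete_hom_Suc)
  qed
  moreover have "Abs_fps (complete_hom x (Suc M)) * (\<Prod>i<Suc M. 1 - fps_const (x i) * fps_X) =
      Abs_fps (complete_hom x (Suc M)) * (1 - fps_const (x M) * fps_X) *
      (\<Prod>i<M. 1 - fps_const (x i) * fps_X)"
    by (simp only: prod.lessThan_Suc mult_ac)
  ultimately show ?case using Suc by (simp only:)
qed

text \<open>At \<open>s\<close> copies of the \<open>r\<close>-th roots of unity the generating function of the complete homogeneous
  polynomials is the inverse of \<open>(1 - X\<^sup>r)\<^sup>s\<close>, with coefficients \<open>s (s + 1) \<dots> (s + q - 1) / q!\<close> at \<open>X\<close>
  to the power \<open>r q\<close>.\<close>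

lemma complete_hom_unity_roots:
  assumes r: "r > 0"
  shows "complete_hom (\<lambda>i. unity_root r ^ i) (r * s) d =
    (if r dvd d then pochhammer (of_nat s) (d div r) / fact (d div r) else 0)"
proof -
  let ?F = "Abs_fps (complete_hom (\<lambda>i. unity_root r ^ i) (r * s))"
  \<comment> \<open>\<open>G s\<close> is the claimed generating function; Pascal's rule for its coefficients reads
    \<open>G (s + 1) * (1 - X\<^sup>r) = G s\<close>.\<close>
  define G :: "nat \<Rightarrow> complex fps" where
    "G s = Abs_fps (\<lambda>d. if r dvd d then pochhammer (of_nat s) (d div r) / fact (d div r) else 0)" for s
  have block: "(\<Prod>i<r * s. 1 - fps_const (unity_root r ^ i) * fps_X) = (1 - fps_X ^ r) ^ s" for s
  proof (induction s)
    case (Suc s)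
    have "(\<Prod>i<r * Suc s. 1 - fps_const (unity_root r ^ i) * fps_X) =
        (\<Prod>i<r * s. 1 - fps_const (unity_root r ^ i) * fps_X) *
        (\<Prod>i\<in>{r * s..<r * s + r}. 1 - fps_const (unity_root r ^ i) * fps_X)"
      by (subst prod.union_disjoint[symmetric]) (auto intro!: prod.cong)
    also have "(\<Prod>i\<in>{r * s..<r * s + r}. 1 - fps_const (unity_root r ^ i) * fps_X) =
        (\<Prod>i<r. 1 - fps_const (unity_root r ^ i) * fps_X)"
      by (rule prod.reindex_bij_witness[of _ "\<lambda>i. r * s + i" "\<lambda>i. i - r * s"])
        (auto simp: le_iff_add power_add power_mult unity_root_power_self[OF r])
    finally show ?case using Suc by (simp add: prod_one_minus_unity_roots[OF r])
  qed simp
  have F: "?F * (1 - fps_X ^ r) ^ s = 1"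
    using complete_hom_fps[where x = "\<lambda>i. unity_root r ^ i" and M = "r * s"] unfolding block .
  have G_Suc: "G (Suc s) * (1 - fps_X ^ r) = G s" for s
  proof (rule fps_ext)
    fix d
    have nth: "fps_nth (G (Suc s) * (1 - fps_X ^ r)) d =
        fps_nth (G (Suc s)) d - (if d < r then 0 else fps_nth (G (Suc s)) (d - r))"
      by (simp add: right_diff_distrib fps_X_power_mult_right_nth)
    show "fps_nth (G (Suc s) * (1 - fps_X ^ r)) d = fps_nth (G s) d"
    proof (cases "r dvd d")
      case False
      moreover have "\<not> r dvd d - r" if "\<not> d < r" using False that
        by (simp add: dvd_minus_self)
      ultimately show ?thesis unfolding nth by (simp add: G_def)
    next
      case True
      then obtain q where q: "d = r * q" by auto
      show ?thesis
      proof (cases q)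
        case 0
        with q r show ?thesis unfolding nth by (simp add: G_def)
      next
        case (Suc p)
        have "fps_nth (G (Suc s)) d = pochhammer (of_nat s + 1) (Suc p) / fact (Suc p)"
          "fps_nth (G s) d = pochhammer (of_nat s) (Suc p) / fact (Suc p)"
          "fps_nth (G (Suc s)) (d - r) = pochhammer (of_nat s + 1) p / fact p" "\<not> d < r"
          using r by (simp_all add: q Suc G_def add.commute)
        moreover have "P * (S + 1 + c) / ((c + 1) * F) - P / F = S * P / ((c + 1) * F)"
          if "c + 1 \<noteq> 0" for P S c F :: complex
        proof -
          have "P / F = (c + 1) * P / ((c + 1) * F)" using that by simp
          then show ?thesis by (simp only: diff_divide_distrib[symmetric]) (simp add: algebra_simps)
        qed
        note this[of "of_nat p" "pochhammer (of_nat s + 1) p" "of_nat s" "fact p"]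
        moreover have "(of_nat p + 1 :: complex) \<noteq> 0" by (metis of_nat_Suc of_nat_neq_0 add.commute)
        moreover have "(fact (Suc p) :: complex) = (of_nat p + 1) * fact p" by simp
        ultimately show ?thesis
          unfolding nth
          by (simp only: pochhammer_Suc[of "of_nat s + 1"] pochhammer_rec[of "of_nat s"] if_False not_False_eq_True)
      qed
    qed
  qed
  have "G s * (1 - fps_X ^ r) ^ s = 1" for s
  proof (induction s)
    case 0
    have "G 0 = 1" using r by (intro fps_ext) (auto simp: G_def pochhammer_0_left elim: dvdE)
    then show ?case by simp
  next
    case (Suc s)
    have "G (Suc s) * (1 - fps_X ^ r) ^ Suc s = G (Suc s) * (1 - fps_X ^ r) * (1 - fps_X ^ r) ^ s"
      by (simp only: power_Suc mult.assoc)
    then show ?case using Suc by (simp only: G_Suc)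
  qed
  then have G: "(1 - fps_X ^ r) ^ s * G s = 1" by (simp only: mult.commute)
  have "?F = ?F * ((1 - fps_X ^ r) ^ s * G s)" by (simp only: G mult_1_right)
  also have "\<dots> = G s" by (simp only: mult.assoc[symmetric] F mult_1)
  finally have "?F = G s" .
  then have "fps_nth ?F d = fps_nth (G s) d" by simp
  then show ?thesis by (simp add: G_def)
qed

lemma coeff_mult_degree_le:
  fixes p q :: "'a::comm_semiring_0 poly"
  assumes "degree p \<le> a" "degree q \<le> b"
  shows "coeff (p * q) (a + b) = coeff p a * coeff q b"
proof -
  have "coeff (p * q) (a + b) = (\<Sum>i\<le>a + b. coeff p i * coeff q (a + b - i))" by (rule coeff_mult)
  also have "\<dots> = (\<Sum>i\<in>{a}. coeff p i * coeff q (a + b - i))"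
  proof (rule sum.mono_neutral_right)
    show "\<forall>i\<in>{..a + b} - {a}. coeff p i * coeff q (a + b - i) = 0"
    proof
      fix i assume i: "i \<in> {..a + b} - {a}"
      then consider "i > a" | "a + b - i > b" by fastforce
      then show "coeff p i * coeff q (a + b - i) = 0"
        by cases (use assms in \<open>simp_all add: coeff_eq_0\<close>)
    qed
  qed auto
  finally show ?thesis by simp
qed

lemma poly_eqI_of_nat:
  fixes p q :: "'a::{idom,ring_char_0} poly"
  assumes "\<And>s. poly p (of_nat s) = poly q (of_nat s)"
  shows "p = q"
proof (rule ccontr)
  assume "p \<noteq> q"
  then have "finite {x. poly (p - q) x = 0}" by (intro poly_roots_finite) simp
  moreover have "range of_nat \<subseteq> {x. poly (p - q) x = 0}" using assms by auto
  ultimately have "finite (range (of_nat :: nat \<Rightarrow> 'a))" by (rule rev_finite_subset)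
  then show False by (simp add: finite_image_iff inj_of_nat)
qed

text \<open>As a function of the number \<open>s\<close> of copies of the roots of unity, \<open>h\<^sub>d\<close> is a polynomial.\<close>

definition complete_hom_poly :: "nat \<Rightarrow> nat \<Rightarrow> complex poly" where
  "complete_hom_poly r d =
     (if r dvd d then Polynomial.smult (1 / fact (d div r)) (pochhammer [:0, 1:] (d div r)) else 0)"

lemma poly_complete_hom_poly:
  assumes "r > 0"
  shows "poly (complete_hom_poly r d) (of_nat s) = complete_hom (\<lambda>i. unity_root r ^ i) (r * s) d"
proof -
  have "poly (pochhammer [:0, 1:] m) z = pochhammer z m" for m and z :: complex
    by (simp add: pochhammer_prod poly_prod)
  then show ?thesis
    by (simp add: complete_hom_poly_def complete_hom_unity_roots[OF assms])
qed

lemma pochhammer_var: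
  "degree (pochhammer [:0, 1 :: 'a::comm_ring_1:] m) \<le> m"
  "coeff (pochhammer [:0, 1 :: 'a::comm_ring_1:] m) m = 1"
proof (induction m)
  case (Suc m)
  have fac: "[:0, 1:] + of_nat m = [:of_nat m, 1 :: 'a:]"
    by (simp add: of_nat_poly)
  have deg: "degree [:of_nat m, 1 :: 'a:] \<le> 1" by simp
  {
    case 1
    have "degree (pochhammer [:0, 1 :: 'a:] (Suc m)) \<le>
        degree (pochhammer [:0, 1 :: 'a:] m) + degree [:of_nat m, 1 :: 'a:]"
      unfolding pochhammer_Suc fac by (rule degree_mult_le)
    with Suc.IH(1) deg show ?case by linarith
  next
    case 2
    show ?case
      using coeff_mult_degree_le[OF Suc.IH(1) deg] Suc.IH(2) by (simp add: pochhammer_Suc fac)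
  }
qed simp_all

lemma complete_hom_poly_top:
  "degree (complete_hom_poly r (r * m)) \<le> m"
  "r > 0 \<Longrightarrow> coeff (complete_hom_poly r (r * m)) m = 1 / fact m"
  using pochhammer_var[of m, where 'a = complex]
  by (cases "r = 0"; simp add: complete_hom_poly_def order_trans[OF degree_smult_le])+

section \<open>Character values as coefficients\<close>

text \<open>The Frobenius characteristic of \<open>\<chi>\<close> at \<open>s\<close> copies of the \<open>r\<close>-th roots of unity, as a polynomial in
  \<open>s\<close>: there the power sum \<open>p\<^sub>c\<close> is \<open>r s\<close> if \<open>r\<close> divides \<open>c\<close>, and 0 otherwise.\<close>

definition cycle_poly :: "nat \<Rightarrow> nat \<Rightarrow> ((nat \<Rightarrow> nat) \<Rightarrow> complex) \<Rightarrow> complex poly" where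
  "cycle_poly r N \<chi> = Polynomial.smult (1 / fact N) (\<Sum>w\<in>carrier (sym_group N).
     Polynomial.smult (\<chi> w) (\<Prod>c\<in>#cycle_type N w. if r dvd c then [:0, of_nat r:] else 0))"

lemma poly_cycle_poly:
  assumes "r > 0"
  shows "poly (cycle_poly r N \<chi>) (of_nat s) =
    cpoly_eval (\<lambda>i. unity_root r ^ i) (frobenius_characteristic N \<chi> (r * s))"
proof -
  have "poly (\<Prod>c\<in>#A. if r dvd c then [:0, of_nat r:] else 0) (of_nat s) =
      (\<Prod>c\<in>#A. \<Sum>i<r * s. (unity_root r ^ i) ^ c)" for A :: "nat multiset"
    by (induction A) (simp_all add: power_sum_unity_roots[OF assms] mult_ac)
  then show ?thesis
    by (simp add: cycle_poly_def cpoly_eval_frobenius poly_sum)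
qed

lemma cycle_factor_prod:
  "(\<Prod>c\<in>#A. if r dvd c then [:0, of_nat r:] else 0 :: complex poly) =
    (if \<forall>c\<in>#A. r dvd c then monom (of_nat r ^ size A) (size A) else 0)"
proof (induction A)
  case (add c A)
  have "[:0, of_nat r :: complex:] = monom (of_nat r) 1" by (simp add: monom_altdef)
  then have "[:0, of_nat r:] * monom (of_nat r ^ size A) (size A) =
      (monom (of_nat r ^ Suc (size A)) (Suc (size A)) :: complex poly)"
    by (simp only: mult_monom) simp
  with add show ?case by auto
qed (simp add: monom_0)

text \<open>Among the partitions of \<open>r m\<close> into multiples of \<open>r\<close>, only the one with all parts equal to \<open>r\<close> has
  as many as \<open>m\<close> parts. This is why the coefficient of \<open>s\<^sup>m\<close> isolates the cycle type \<open>r\<^sup>m\<close>.\<close>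

lemma size_le_if_dvd:
  assumes "\<forall>c\<in>#A. r dvd c" "0 \<notin># A"
  shows "r * size A \<le> sum_mset A"
    and "sum_mset A = r * size A \<Longrightarrow> A = replicate_mset (size A) r"
proof -
  have le: "r \<le> c" if "c \<in># A" for c
    using assms that by (metis dvd_imp_le gr0I)
  have split: "sum_mset A = r * size A + (\<Sum>c\<in>#A. c - r)" if "\<forall>c\<in>#A. r \<le> c" for A :: "nat multiset"
    using that by (induction A) auto
  note eq = split[of A]
  with le show "r * size A \<le> sum_mset A" by auto
  assume "sum_mset A = r * size A"
  with eq le have "(\<Sum>c\<in>#A. c - r) = 0" by auto
  then have "\<forall>c\<in>#A. c = r" using le by (force simp: sum_mset_0_iff)
  then have "set_mset A \<subseteq> {r}" by auto
  then show "A = replicate_mset (size A) r" by (rule set_mset_subset_singletonD)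
qed

lemma dvd_sum_mset:
  fixes A :: "nat multiset"
  shows "\<forall>c\<in>#A. r dvd c \<Longrightarrow> r dvd sum_mset A"
  by (induction A) auto

lemma cycle_poly_eq_0:
  assumes "\<not> r dvd N"
  shows "cycle_poly r N \<chi> = 0"
proof -
  have "\<not> (\<forall>c\<in>#cycle_type N w. r dvd c)" if "w \<in> carrier (sym_group N)" for w
  proof
    assume "\<forall>c\<in>#cycle_type N w. r dvd c"
    then have "r dvd sum_mset (cycle_type N w)" by (rule dvd_sum_mset)
    with assms sum_mset_cycle_type(1)[OF that] show False by simp
  qed
  then have "(\<Sum>w\<in>carrier (sym_group N). Polynomial.smult (\<chi> w)
      (\<Prod>c\<in>#cycle_type N w. if r dvd c then [:0, of_nat r:] else 0)) = 0"
    by (intro sum.neutral ballI) (simp only: cycle_factor_prod if_False smult_0_right)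
  then show ?thesis by (simp add: cycle_poly_def)
qed

lemma cycle_poly_degree_coeff:
  fixes r m :: nat
  defines "N \<equiv> r * m"
  assumes r: "r > 0"
  shows "degree (cycle_poly r N \<chi>) \<le> m"
    and "coeff (cycle_poly r N \<chi>) m = of_nat r ^ m / fact N *
      (\<Sum>w | w \<in> carrier (sym_group N) \<and> cycle_type N w = replicate_mset m r. \<chi> w)"
proof -
  let ?P = "\<lambda>w. \<Prod>c\<in>#cycle_type N w. if r dvd c then [:0, of_nat r:] else 0 :: complex poly"
  have fin: "finite (carrier (sym_group N))"
    by (simp add: sym_group_def finite_permutations)
  have deg: "degree (?P w) \<le> m" and coeff: "coeff (?P w) m =
      (if cycle_type N w = replicate_mset m r then of_nat r ^ m else 0)"
    if w: "w \<in> carrier (sym_group N)" for w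
  proof -
    let ?A = "cycle_type N w"
    have sum: "sum_mset ?A = r * m" and pos: "0 \<notin># ?A"
      using sum_mset_cycle_type[OF w] by (simp_all add: N_def)
    have le: "size ?A \<le> m" if "\<forall>c\<in>#?A. r dvd c"
      using size_le_if_dvd(1)[OF that pos] sum r by simp
    have eq: "?A = replicate_mset m r" if "\<forall>c\<in>#?A. r dvd c" "size ?A = m"
      using size_le_if_dvd(2)[OF that(1) pos] sum that(2) by simp
    show "degree (?P w) \<le> m"
      unfolding cycle_factor_prod using le by (auto intro: order_trans[OF degree_monom_le])
    show "coeff (?P w) m = (if ?A = replicate_mset m r then of_nat r ^ m else 0)"
    proof (cases "?A = replicate_mset m r")
      case True
      then show ?thesis unfolding cycle_factor_prod by (auto split: if_splits)
    next
      case False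
      with eq show ?thesis unfolding cycle_factor_prod by auto
    qed
  qed
  show "degree (cycle_poly r N \<chi>) \<le> m"
    unfolding cycle_poly_def
    by (intro order_trans[OF degree_smult_le] degree_sum_le fin) (use deg in auto)
  have "(\<Sum>w\<in>carrier (sym_group N). \<chi> w * coeff (?P w) m) =
      (\<Sum>w\<in>carrier (sym_group N). if cycle_type N w = replicate_mset m r then \<chi> w * of_nat r ^ m else 0)"
    by (rule sum.cong) (simp_all add: coeff)
  also have "\<dots> = (\<Sum>w | w \<in> carrier (sym_group N) \<and> cycle_type N w = replicate_mset m r. \<chi> w * of_nat r ^ m)"
    using fin by (simp add: sum.inter_filter)
  finally have *: "(\<Sum>w\<in>carrier (sym_group N). \<chi> w * coeff (?P w) m) = \<dots>" .
  show "coeff (cycle_poly r N \<chi>) m = of_nat r ^ m / fact N *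
      (\<Sum>w | w \<in> carrier (sym_group N) \<and> cycle_type N w = replicate_mset m r. \<chi> w)"
    unfolding cycle_poly_def
    by (simp only: coeff_smult coeff_sum *) (simp add: sum_distrib_left sum_distrib_right mult_ac)
qed

lemma cycle_poly_trivial:
  assumes "r > 0"
  shows "cycle_poly r N (\<lambda>_. 1) = complete_hom_poly r N"
proof (rule poly_eqI_of_nat)
  fix s
  have "(\<Prod>c\<in>#cycle_type N w. f c) = (\<Prod>C\<in>orbit w ` {1..N}. f (card C))"
    for f :: "nat \<Rightarrow> complex" and w
    by (simp add: cycle_type_def prod_unfold_prod_mset multiset.map_comp comp_def)
  then show "poly (cycle_poly r N (\<lambda>_. 1)) (of_nat s) = poly (complete_hom_poly r N) (of_nat s)"
    using cycle_index_eq_complete_hom[of "{1..N}" "\<lambda>i. unity_root r ^ i" "r * s"]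
    by (simp add: poly_cycle_poly[OF assms] poly_complete_hom_poly[OF assms]
        cpoly_eval_frobenius sym_group_def)
qed

text \<open>The coefficient of \<open>s\<^sup>m\<close> is the character value times \<open>r\<^sup>m / (r m)!\<close> times the number of permutations
  of cycle type \<open>r\<^sup>m\<close>. For the trivial character it is the coefficient \<open>1 / m!\<close> of \<open>s\<^sup>m\<close> in the polynomial
  of \<open>h\<^sub>r\<^sub>m\<close>, and this determines the last two factors together without a count.\<close>

theorem coeff_cycle_poly_character:
  assumes r: "r > 0" and \<chi>: "is_character (r * m) \<chi>"
  shows "coeff (cycle_poly r (r * m) \<chi>) m = character_value (r * m) \<chi> (replicate_mset m r) / fact m"
proof -
  let ?T = "{w. w \<in> carrier (sym_group (r * m)) \<and> cycle_type (r * m) w = replicate_mset m r}"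
  have "coeff (cycle_poly r (r * m) \<chi>) m = of_nat r ^ m / fact (r * m) *
      (\<Sum>w\<in>?T. character_value (r * m) \<chi> (replicate_mset m r))"
    unfolding cycle_poly_degree_coeff(2)[OF r]
    using is_character_eq_character_value[OF \<chi>] by simp
  also have "\<dots> = coeff (cycle_poly r (r * m) (\<lambda>_. 1)) m *
      character_value (r * m) \<chi> (replicate_mset m r)"
    unfolding cycle_poly_degree_coeff(2)[OF r] by simp
  finally show ?thesis by (simp add: cycle_poly_trivial[OF r] complete_hom_poly_top(2)[OF r])
qed

lemma part_Cons: "part (n # lam) = case_nat n (part lam)"
  by (auto simp: part_def fun_eq_iff split: nat.split)

lemma part_Nil: "part [] = (\<lambda>_. 0)"
  by (auto simp: part_def)

lemma part_replicate_1: "part (replicate j (Suc 0)) = (\<lambda>i. if i < j then 1 else 0)"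
  by (auto simp: part_def)

lemma is_partition_part:
  assumes "is_partition lam"
  shows "antimono (part lam)" "i \<ge> length lam \<Longrightarrow> part lam i = 0"
    and "i < length lam \<Longrightarrow> part lam i \<ge> 1" and "length lam \<le> sum_list lam"
proof -
  have "sorted_wrt (\<ge>) lam" "\<forall>l\<in>set lam. l \<ge> 1" using assms by (simp_all add: is_partition_def)
  then show "antimono (part lam)"
    unfolding antimono_iff_le_Suc by (auto simp: part_def sorted_wrt_iff_nth_less)
  show "i \<ge> length lam \<Longrightarrow> part lam i = 0" by (simp add: part_def)
  show "i < length lam \<Longrightarrow> part lam i \<ge> 1"
    using \<open>\<forall>l\<in>set lam. l \<ge> 1\<close> by (simp add: part_def)
  show "length lam \<le> sum_list lam"
    using \<open>\<forall>l\<in>set lam. l \<ge> 1\<close> by (induction lam) auto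
qed

lemma cycle_poly_skew_character:
  assumes "r > 0" "frobenius_characteristic N \<chi> = skew_schur lam mu"
  shows "poly (cycle_poly r N \<chi>) (of_nat s) =
    tableau_sum (\<lambda>i. unity_root r ^ i) (r * s) (part lam) (part mu)"
  by (simp add: poly_cycle_poly[OF assms(1)] assms(2) cpoly_eval_skew_schur)

section \<open>Rationality of the skew character values\<close>

definition rat_coeffs :: "complex poly \<Rightarrow> bool" where
  "rat_coeffs p \<longleftrightarrow> (\<forall>i. coeff p i \<in> \<rat>)"

lemma rat_coeffs_closed:
  "rat_coeffs 0" "rat_coeffs 1" "rat_coeffs p \<Longrightarrow> rat_coeffs q \<Longrightarrow> rat_coeffs (p + q)"
  "rat_coeffs p \<Longrightarrow> rat_coeffs q \<Longrightarrow> rat_coeffs (p * q)"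
  "c \<in> \<rat> \<Longrightarrow> rat_coeffs p \<Longrightarrow> rat_coeffs (Polynomial.smult c p)"
  "c \<in> \<rat> \<Longrightarrow> rat_coeffs p \<Longrightarrow> rat_coeffs (pCons c p)"
  by (auto simp: rat_coeffs_def coeff_mult coeff_1 coeff_pCons intro!: Rats_sum split: nat.split)

lemma rat_coeffs_sum: "(\<And>a. a \<in> A \<Longrightarrow> rat_coeffs (f a)) \<Longrightarrow> rat_coeffs (\<Sum>a\<in>A. f a)"
  by (induction A rule: infinite_finite_induct) (auto intro: rat_coeffs_closed)

lemma rat_coeffs_prod: "(\<And>a. a \<in> A \<Longrightarrow> rat_coeffs (f a)) \<Longrightarrow> rat_coeffs (\<Prod>a\<in>A. f a)"
  by (induction A rule: infinite_finite_induct) (auto intro: rat_coeffs_closed)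

lemma rat_coeffs_complete_hom_poly: "rat_coeffs (complete_hom_poly r d)"
proof -
  have "rat_coeffs (pochhammer [:0, 1:] m)" for m
    unfolding pochhammer_prod of_nat_poly
    by (intro rat_coeffs_prod) (auto intro!: rat_coeffs_closed)
  moreover have "(1 / fact m :: complex) \<in> \<rat>" for m
    by (metis Rats_1 Rats_divide Rats_of_nat of_nat_fact)
  ultimately show ?thesis by (auto simp: complete_hom_poly_def intro: rat_coeffs_closed)
qed

text \<open>By the Jacobi-Trudi identity the polynomial of a skew character is a determinant of
  polynomials of complete homogeneous functions, and these have rational coefficients.\<close>

lemma rat_coeffs_cycle_poly:
  assumes r: "r > 0" and "frobenius_characteristic N \<chi> = skew_schur lam mu"
    and lam: "is_partition lam" and mu: "is_partition mu"
    and le: "part mu \<le> part lam" and len: "length mu \<le> length lam"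
  shows "rat_coeffs (cycle_poly r N \<chi>)"
proof -
  define L where "L = length lam"
  define H where "H d = (if d < 0 then 0 else complete_hom_poly r (nat d))" for d :: int
  define D where "D = (\<Sum>p | p permutes {0..<L}. Polynomial.smult (signof p)
      (\<Prod>i = 0..<L. H (int (part lam i) - int i - int (part mu (p i)) + int (p i))))"
  have "cycle_poly r N \<chi> = D"
  proof (rule poly_eqI_of_nat)
    fix s
    let ?x = "\<lambda>i. unity_root r ^ i"
    have H: "poly (H d) (of_nat s) = complete_hom_int ?x (r * s) d" for d
      by (simp add: H_def complete_hom_int_def poly_complete_hom_poly[OF r])
    have "poly (cycle_poly r N \<chi>) (of_nat s) = det (jacobi_trudi ?x (r * s) L (part lam) (part mu))"
      using le len by (subst det_jacobi_trudi)
        (simp_all add: L_def cycle_poly_skew_character[OF r assms(2)] is_partition_part lam mu)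
    also have "\<dots> = poly D (of_nat s)"
      by (subst det_def'[of _ L]) (auto simp: D_def jacobi_trudi_def poly_sum poly_prod H
        permutes_in_image intro!: sum.cong prod.cong arg_cong2[where f = "(*)"])
    finally show "poly (cycle_poly r N \<chi>) (of_nat s) = poly D (of_nat s)" .
  qed
  moreover have "rat_coeffs (H d)" for d
    by (simp add: H_def rat_coeffs_complete_hom_poly rat_coeffs_closed)
  then have "rat_coeffs D"
    unfolding D_def by (intro rat_coeffs_sum rat_coeffs_closed(5) rat_coeffs_prod) auto
  ultimately show ?thesis by simp
qed

text \<open>A binomial coefficient with fixed lower argument is a polynomial in the upper one, and \<open>(n + k) / r\<close>
  is linear in \<open>n\<close>.\<close>

lemma binomial_poly:
  fixes k r q :: nat
  assumes "r > 0"
  obtains B :: "rat poly" where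
    "\<And>n. r dvd n + k \<Longrightarrow> poly B (of_nat n) = of_nat ((n + k) div r choose q)"
proof
  let ?B = "Polynomial.smult (1 / fact q) (\<Prod>i = 0..<q. [:of_nat k / of_nat r - of_nat i, 1 / of_nat r:]) :: rat poly"
  fix n assume "r dvd n + k"
  then obtain m where "n + k = r * m" by blast
  then have "(of_nat n + of_nat k :: rat) = of_nat r * of_nat ((n + k) div r)"
    using assms by (simp flip: of_nat_add of_nat_mult)
  then have "(of_nat ((n + k) div r) :: rat) = of_nat n / of_nat r + of_nat k / of_nat r"
    using assms by (simp add: field_simps)
  then show "poly ?B (of_nat n) = of_nat ((n + k) div r choose q)"
    by (simp add: binomial_gbinomial gbinomial_prod_rev poly_prod algebra_simps)
qed

section \<open>The character formula\<close>

theorem proposition3p2: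
  fixes lam :: "nat list" and k t r :: nat
    and \<chi> \<psi> :: "nat \<Rightarrow> (nat \<Rightarrow> nat) \<Rightarrow> complex"
  assumes "is_partition lam" and "k = sum_list lam" and "t = length lam" and "r > 0"
    and "\<And>n. part lam 0 \<le> n \<Longrightarrow> is_irreducible_character_of (n + k) (n # lam) (\<chi> n)"
    and "\<And>j. j \<le> t \<Longrightarrow> is_skew_character (k - j) lam (replicate j 1) (\<psi> j)"
  shows
    "(\<forall>n. part lam 0 \<le> n \<and> r dvd n + k \<longrightarrow>
        character_value (n + k) (\<chi> n) (replicate_mset ((n + k) div r) r) =
        (\<Sum>j | j \<le> t \<and> r dvd k - j.
           (- 1) ^ j * of_nat (((n + k) div r) choose ((k - j) div r)) *
           character_value (k - j) (\<psi> j) (replicate_mset ((k - j) div r) r))) \<and>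
     (\<exists>p :: rat poly. \<forall>n. part lam 0 \<le> n \<and> r dvd n + k \<longrightarrow>
        character_value (n + k) (\<chi> n) (replicate_mset ((n + k) div r) r) =
        of_rat (poly p (of_nat n)))"
proof -
  note lam = is_partition_part[OF assms(1), folded assms(3)]
  have tk: "t \<le> k" using lam(4) assms(2) by simp
  have \<psi>: "is_character (k - j) (\<psi> j)"
    "frobenius_characteristic (k - j) (\<psi> j) = skew_schur lam (replicate j 1)" if "j \<le> t" for j
    using assms(6)[OF that] by (simp_all add: is_skew_character_def)
  let ?v = "\<lambda>j. character_value (k - j) (\<psi> j) (replicate_mset ((k - j) div r) r)"
  have formula: "character_value (n + k) (\<chi> n) (replicate_mset ((n + k) div r) r) =
      (\<Sum>j | j \<le> t \<and> r dvd k - j. (- 1) ^ j * of_nat (((n + k) div r) choose ((k - j) div r)) * ?v j)"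
    if n: "part lam 0 \<le> n" and dvd: "r dvd n + k" for n
  proof -
    define m where "m = (n + k) div r"
    have m: "n + k = r * m" using dvd by (simp add: m_def)
    have \<chi>: "is_character (n + k) (\<chi> n)"
      "frobenius_characteristic (n + k) (\<chi> n) = skew_schur (n # lam) []"
      using assms(5)[OF n]
      by (auto simp: is_irreducible_character_of_def is_irreducible_character_def is_character_def
          irreducible_representation_def)
    \<comment> \<open>The expansion of the Schur function of \<open>(n, \<lambda>)\<close>, read as an identity of polynomials in \<open>s\<close>.\<close>
    have "cycle_poly r (n + k) (\<chi> n) =
        (\<Sum>j\<le>t. Polynomial.smult ((- 1) ^ j) (complete_hom_poly r (n + j) * cycle_poly r (k - j) (\<psi> j)))"
    proof (rule poly_eqI_of_nat)
      fix s
      show "poly (cycle_poly r (n + k) (\<chi> n)) (of_nat s) = poly (\<Sum>j\<le>t. Polynomial.smult ((- 1) ^ j)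
          (complete_hom_poly r (n + j) * cycle_poly r (k - j) (\<psi> j))) (of_nat s)"
        using tableau_sum_first_row_expansion[OF lam(1-3) n,
          where t = t and x = "\<lambda>i. unity_root r ^ i" and M = "r * s"]
        by (simp add: poly_sum cycle_poly_skew_character[OF assms(4) \<chi>(2)]
            cycle_poly_skew_character[OF assms(4) \<psi>(2)] poly_complete_hom_poly[OF assms(4)]
            part_Cons part_Nil part_replicate_1 mult.assoc)
    qed
    then have "coeff (cycle_poly r (n + k) (\<chi> n)) m =
        (\<Sum>j\<le>t. (- 1) ^ j * coeff (complete_hom_poly r (n + j) * cycle_poly r (k - j) (\<psi> j)) m)"
      by (simp add: coeff_sum)
    \<comment> \<open>The coefficients involved have the denominators \<open>m!\<close>, \<open>(m - q)!\<close> and \<open>q!\<close>, whence the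
      binomial coefficient.\<close>
    also have "\<dots> = (\<Sum>j\<le>t. if r dvd k - j then
        (- 1) ^ j * of_nat (m choose ((k - j) div r)) * ?v j / fact m else 0)"
    proof (rule sum.cong[OF refl])
      fix j assume "j \<in> {..t}"
      then have j: "j \<le> t" by simp
      show "(- 1) ^ j * coeff (complete_hom_poly r (n + j) * cycle_poly r (k - j) (\<psi> j)) m =
          (if r dvd k - j then (- 1) ^ j * of_nat (m choose ((k - j) div r)) * ?v j / fact m else 0)"
      proof (cases "r dvd k - j")
        case True
        define q where "q = (k - j) div r"
        have q: "k - j = r * q" using True by (simp add: q_def)
        have "n + j + r * q = r * m" using m q j tk by simp
        then have "n + j = r * (m - q)" by (simp add: right_diff_distrib')
        moreover have "q \<le> m" using \<open>n + j + r * q = r * m\<close> assms(4)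
          by (metis le_add2 mult_le_cancel1)
        ultimately have "coeff (complete_hom_poly r (n + j) * cycle_poly r (k - j) (\<psi> j)) (m - q + q) =
            1 / fact (m - q) * (?v j / fact q)"
          using \<psi>(1)[OF j] assms(4) unfolding q
          by (subst coeff_mult_degree_le)
            (simp_all add: complete_hom_poly_top cycle_poly_degree_coeff(1) coeff_cycle_poly_character)
        with True \<open>q \<le> m\<close> show ?thesis
          by (simp add: q_def[symmetric] binomial_fact field_simps)
      qed (simp add: cycle_poly_eq_0)
    qed
    also have "\<dots> = (\<Sum>j | j \<le> t \<and> r dvd k - j. (- 1) ^ j * of_nat (m choose ((k - j) div r)) * ?v j) / fact m"
      by (simp add: sum_divide_distrib sum.inter_filter[symmetric])
    finally show ?thesis
      using coeff_cycle_poly_character[OF assms(4), of m "\<chi> n"] \<chi>(1) unfolding m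
      by (simp add: assms(4))
  qed
  moreover have "\<exists>p :: rat poly. \<forall>n. part lam 0 \<le> n \<and> r dvd n + k \<longrightarrow>
      character_value (n + k) (\<chi> n) (replicate_mset ((n + k) div r) r) = of_rat (poly p (of_nat n))"
  proof -
    have "\<exists>c :: rat. ?v j = of_rat c" if j: "j \<le> t" "r dvd k - j" for j
    proof -
      obtain q where q: "k - j = r * q" using j(2) by auto
      have "rat_coeffs (cycle_poly r (k - j) (\<psi> j))"
      proof (rule rat_coeffs_cycle_poly[OF assms(4) \<psi>(2)[OF j(1)] assms(1)])
        show "is_partition (replicate j 1)"
          by (simp add: is_partition_def sorted_wrt_iff_nth_less)
        show "part (replicate j 1) \<le> part lam"
          using lam(3) j(1) by (auto simp: part_replicate_1 le_fun_def)
      qed (use j(1) assms(3) in simp)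
      then have "coeff (cycle_poly r (k - j) (\<psi> j)) q * fact q \<in> \<rat>"
        unfolding rat_coeffs_def by (metis Rats_mult Rats_of_nat of_nat_fact)
      then have "?v j \<in> \<rat>"
        using coeff_cycle_poly_character[OF assms(4), of q "\<psi> j"] \<psi>(1)[OF j(1)] assms(4)
        unfolding q by simp
      then show ?thesis by (auto simp: Rats_def)
    qed
    then obtain c :: "nat \<Rightarrow> rat" where c: "\<And>j. j \<le> t \<Longrightarrow> r dvd k - j \<Longrightarrow> ?v j = of_rat (c j)"
      by metis
    have "\<exists>B :: rat poly. \<forall>n. r dvd n + k \<longrightarrow>
        poly B (of_nat n) = of_nat ((n + k) div r choose q)" for q
      by (rule binomial_poly[OF assms(4)]) blast
    then obtain B :: "nat \<Rightarrow> rat poly" where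
      B: "r dvd n + k \<Longrightarrow> poly (B q) (of_nat n) = of_nat ((n + k) div r choose q)" for q n
      by metis
    let ?p = "\<Sum>j | j \<le> t \<and> r dvd k - j. Polynomial.smult ((- 1) ^ j * c j) (B ((k - j) div r))"
    have "character_value (n + k) (\<chi> n) (replicate_mset ((n + k) div r) r) = of_rat (poly ?p (of_nat n))"
      if n: "part lam 0 \<le> n" "r dvd n + k" for n
    proof -
      have "character_value (n + k) (\<chi> n) (replicate_mset ((n + k) div r) r) =
          (\<Sum>j | j \<le> t \<and> r dvd k - j.
            (- 1) ^ j * of_nat (((n + k) div r) choose ((k - j) div r)) * of_rat (c j))"
        unfolding formula[OF n] by (rule sum.cong[OF refl]) (simp only: mem_Collect_eq c)
      also have "\<dots> = of_rat (poly ?p (of_nat n))"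
        by (simp add: poly_sum B[OF n(2)] of_rat_sum of_rat_mult of_rat_power of_rat_minus mult_ac)
      finally show ?thesis .
    qed
    then show ?thesis by blast
  qed
  ultimately show ?thesis by blast
qed

end
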